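(* Let $R$ be a totally ordered set, let $U=\bigoplus_{j\in J}\mathbb{I}\lceil b'_j,d'_j\rfloor$ and $V=\bigoplus_{i\in I}\mathbb{I}\lceil b_i,d_i\rfloor$ be persistence modules of finite type indexed by $R$ ($I,J$ finite), with $J$ and $I$ given standard orders for the pair $(U,V)$, and let $X$ be a matrix representing a morphism $\varphi\colon U\to V$. Let $P_I,P_J,p,p'$ be the pivot data of $X$ defined in the context. Then the persistence module $\operatorname{im}\varphi$ has a barcode consisting of a bar $\lceil b'_j,d_i\rfloor$ for each nontrivial pivot position $i,j$. The factorization of $\varphi$ into the map $U\to\operatorname{im}\varphi$, defined by restricting the codomain of $\varphi$, and the inclusion $\operatorname{im}\varphi\to V$, can be represented in two ways: (1) Index the bars of $\operatorname{im}\varphi$ by $P_I$: $\operatorname{im}\varphi\cong\bigoplus_{i\in P_I}\mathbb{I}\lceil b'_{p'(i)},d_i\rfloor$. Let $SX$ be obtained by ordered row reduction of $X$. Then (for a suitable such isomorphism) $U\to\operatorname{im}\varphi$ is represented by the rows of $SX$ indexed by $P_I$, and $\operatorname{im}\varphi\to V$ is represented by the columns of $S^{-1}$ indexed by $P_I$. (2) Index the bars of $\operatorname{im}\varphi$ by $P_J$: $\operatorname{im}\varphi\cong\bigoplus_{j\in P_J}\mathbb{I}\lceil b'_j,d_{p(j)}\rfloor$. Let $XT$ be obtained by ordered column reduction of $X$. Then (for a suitable such isomorphism) $U\to\operatorname{im}\varphi$ is represented by the rows of $T^{-1}$ indexed by $P_J$, and $\operatorname{im}\varphi\to V$ is represented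 by the columns of $XT$ indexed by $P_J$.
   Context: Fix a field $F$; all vector spaces are over $F$. A persistence module indexed by $R$ is a functor from the poset $R$ to vector spaces; morphisms are natural transformations; direct sums, images, kernels, cokernels are pointwise. A cut of $R$ is a pair $c=(c^\downarrow,c^\uparrow)$ of (possibly empty) subsets with $c^\downarrow\cup c^\uparrow=R$ and $r_1<r_2$ for all $r_1\in c^\downarrow$, $r_2\in c^\uparrow$; cuts are ordered by inclusion of $c^\downarrow$. For cuts $b\le d$ (birth and death times), $\lceil b,d\rfloor=b^\uparrow\cap d^\downarrow$. The interval module $\mathbb{I}\lceil b,d\rfloor$ is $F$ at $t\in\lceil b,d\rfloor$ and $0$ elsewhere, with identity structure maps inside the interval and zero maps otherwise. Bars $b=d$ (zero modules) are allowed in decompositions. Finite type means isomorphic to a finite direct sum of interval modules. Matrix representation: with respect to finite interval decompositions $A\cong\bigoplus_{j\in J}\mathbb{I}\lceil a'_j,c'_j\rfloor$ and $B\cong\bigoplus_{i\in I}\mathbb{I}\lceil a_i,c_i\rfloor$, a matrix $X=\{x_{i,j}\}$ over $F$ represents a morphism $\varphi\colon A\to B$ if $x_{i,j}=0$ whenever $a_i>a'_j$ or $c_i>c'_j$, and for all $i,j$ and all $t\in\lceil a_i,c_i\rfloor\cap\lceil a'_j,c'_j\rfloor$ the composite $\mathbb{I}\lceil a'_j,c'_j\rfloor_t\to A_t\xrightarrow{\varphi_t}B_t\to\mathbb{I}\lceil a_i,c_i\rfloor_t$ is multiplication by $x_{i,j}$. The $i,j$ position is trivial if $c_i\le a'_j$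 and nontrivial otherwise. Standard orders for $(U,V)$: total orders on $J$ and $I$ with $j<j'$ if $b'_j<b'_{j'}$ and $i<i'$ if $d_i>d_{i'}$ (ties arbitrary). Ordered column reduction of a matrix with ordered rows and columns: process columns from least to greatest. If the current column is zero, move on. Otherwise its first (least-row) nonzero entry is its pivot; add multiples of the current column to each greater column so that the entry in the pivot's row becomes zero; then move on. The result is written $XT$, with $T$ the product of the corresponding elementary matrices (upper triangular with 1's on the diagonal). Ordered row reduction interchanges the roles of rows and columns; its result is written $SX$ with $S$ the product of the elementary matrices (lower triangular with 1's on the diagonal). Both reductions of $X$ give pivots in the same positions. Pivot data: using the pivot positions of the reduction of $X$, $P_I\subseteq I$ is the set of $i$ such that row $i$ has a nontrivial pivot (a pivot in a nontrivial position, i.e. at $(i,j)$ with $b'_j<d_i$), and $P_J\subseteq J$ is the set of $j$ such that column $j$ has a nontrivial pivot. $p\colon P_J\to P_I$ sends $j$ to the row index of the pivot in column $j$, and $p'\colon P_I\to P_J$ sends $i$ to the column index of the pivot in row $i$. *)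

theory Defs
  imports Complex_Main "HOL-Library.Function_Algebras"
begin

subsection \<open>Cuts of a totally ordered set\<close>

typedef (overloaded) 'r cut =
  "{c :: 'r::linorder set \<times> 'r set.
     fst c \<union> snd c = UNIV \<and> (\<forall>r\<^sub>1 \<in> fst c. \<forall>r\<^sub>2 \<in> snd c. r\<^sub>1 < r\<^sub>2)}"
  by (rule exI[of _ "({}, UNIV)"]) auto

definition down :: "'r::linorder cut \<Rightarrow> 'r set" where
  "down c = fst (Rep_cut c)"

definition up :: "'r::linorder cut \<Rightarrow> 'r set" where
  "up c = snd (Rep_cut c)"

lemma down_Un_up: "down c \<union> up c = UNIV"
  using Rep_cut[of c] by (auto simp: down_def up_def)

lemma down_less_up: "r\<^sub>1 \<in> down c \<Longrightarrow> r\<^sub>2 \<in> up c \<Longrightarrow> r\<^sub>1 < r\<^sub>2"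
  using Rep_cut[of c] by (auto simp: down_def up_def)

lemma up_eq: "up c = - down c"
  using down_Un_up[of c] down_less_up[of _ c] by blast

lemma cut_eqI: "down c = down c' \<Longrightarrow> c = c'"
  by (metis Rep_cut_inject down_def up_def up_eq prod_eqI)

instantiation cut :: (linorder) linorder
begin

definition less_eq_cut :: "'a cut \<Rightarrow> 'a cut \<Rightarrow> bool" where
  "c \<le> c' \<longleftrightarrow> down c \<subseteq> down c'"

definition less_cut :: "'a cut \<Rightarrow> 'a cut \<Rightarrow> bool" where
  "c < c' \<longleftrightarrow> down c \<subset> down c'"

instance
proof
  fix c c' :: "'a cut"
  show "c \<le> c' \<or> c' \<le> c"
  proof (rule ccontr)
    assume "\<not> (c \<le> c' \<or> c' \<le> c)"
    then obtain x y where "x \<in> down c" "x \<in> up c'" "y \<in> down c'" "y \<in> up c"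
      unfolding less_eq_cut_def up_eq by auto
    then have "x < y" "y < x"
      using down_less_up by blast+
    then show False by simp
  qed
qed (auto simp: less_eq_cut_def less_cut_def intro: cut_eqI)

end

definition bar :: "'r::linorder cut \<Rightarrow> 'r cut \<Rightarrow> 'r set" where
  "bar b d = up b \<inter> down d"


subsection \<open>Persistence modules\<close>

text \<open>
  The vector spaces of a persistence module are given as linear subspaces of one ambient vector
  space.  Up to isomorphism this is no restriction: any family of vector spaces embeds in its
  direct sum.  Structure maps and morphisms matter only on these subspaces.
\<close>

record ('r, 'f, 'v) pmod =
  smul :: "'f \<Rightarrow> 'v \<Rightarrow> 'v"
  space :: "'r \<Rightarrow> 'v set"
  trans :: "'r \<Rightarrow> 'r \<Rightarrow> 'v \<Rightarrow> 'v"

definition linear_between ::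
  "('f \<Rightarrow> 'v \<Rightarrow> 'v) \<Rightarrow> 'v set \<Rightarrow> ('f \<Rightarrow> 'w \<Rightarrow> 'w) \<Rightarrow> 'w set \<Rightarrow>
    ('v::ab_group_add \<Rightarrow> 'w::ab_group_add) \<Rightarrow> bool" where
  "linear_between sV V sW W f \<longleftrightarrow>
     f ` V \<subseteq> W \<and>
     (\<forall>x\<in>V. \<forall>y\<in>V. f (x + y) = f x + f y) \<and>
     (\<forall>a. \<forall>x\<in>V. f (sV a x) = sW a (f x))"

definition persistence_module ::
  "('r::linorder, 'f::field, 'v::ab_group_add) pmod \<Rightarrow> bool" where
  "persistence_module M \<longleftrightarrow>
     vector_space (smul M) \<and>
     (\<forall>t. module.subspace (smul M) (space M t)) \<and>
     (\<forall>s t. s \<le> t \<longrightarrow>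
        linear_between (smul M) (space M s) (smul M) (space M t) (trans M s t)) \<and>
     (\<forall>t. \<forall>x\<in>space M t. trans M t t x = x) \<and>
     (\<forall>r s t. r \<le> s \<longrightarrow> s \<le> t \<longrightarrow>
        (\<forall>x\<in>space M r. trans M s t (trans M r s x) = trans M r t x))"

definition pmod_hom ::
  "('r::linorder, 'f, 'v::ab_group_add) pmod \<Rightarrow> ('r, 'f, 'w::ab_group_add) pmod \<Rightarrow>
    ('r \<Rightarrow> 'v \<Rightarrow> 'w) \<Rightarrow> bool" where
  "pmod_hom A B \<phi> \<longleftrightarrow>
     (\<forall>t. linear_between (smul A) (space A t) (smul B) (space B t) (\<phi> t)) \<and>
     (\<forall>s t. s \<le> t \<longrightarrow> (\<forall>x\<in>space A s. \<phi> t (trans A s t x) = trans B s t (\<phi> s x)))"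

definition pmod_iso ::
  "('r::linorder, 'f, 'v::ab_group_add) pmod \<Rightarrow> ('r, 'f, 'w::ab_group_add) pmod \<Rightarrow>
    ('r \<Rightarrow> 'v \<Rightarrow> 'w) \<Rightarrow> bool" where
  "pmod_iso A B \<phi> \<longleftrightarrow>
     pmod_hom A B \<phi> \<and> (\<forall>t. bij_betw (\<phi> t) (space A t) (space B t))"

definition pmod_image ::
  "('r, 'f, 'v) pmod \<Rightarrow> ('r, 'f, 'w) pmod \<Rightarrow> ('r \<Rightarrow> 'v \<Rightarrow> 'w) \<Rightarrow> ('r, 'f, 'w) pmod" where
  "pmod_image A B \<phi> = B\<lparr>space := \<lambda>t. \<phi> t ` space A t\<rparr>"

definition direct_sum ::
  "'k set \<Rightarrow> ('k \<Rightarrow> ('r, 'f, 'v::ab_group_add) pmod) \<Rightarrow> ('r, 'f, 'k \<Rightarrow> 'v) pmod" where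
  "direct_sum K M =
     \<lparr>smul = \<lambda>a x k. smul (M k) a (x k),
      space = \<lambda>t. {x. finite {k. x k \<noteq> 0} \<and> (\<forall>k\<in>K. x k \<in> space (M k) t) \<and> (\<forall>k. k \<notin> K \<longrightarrow> x k = 0)},
      trans = \<lambda>s t x k. if k \<in> K then trans (M k) s t (x k) else 0\<rparr>"

definition interval_module ::
  "'r::linorder cut \<Rightarrow> 'r cut \<Rightarrow> ('r, 'f::field, 'f) pmod" where
  "interval_module b d =
     \<lparr>smul = (*),
      space = \<lambda>t. if t \<in> bar b d then UNIV else {0},
      trans = \<lambda>s t x. if s \<in> bar b d \<and> t \<in> bar b d then x else 0\<rparr>"

text \<open>
  \<open>\<alpha>\<close> is an isomorphism from \<open>A\<close> to the finite direct sum of the interval modules with births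
  \<open>b k\<close> and deaths \<open>d k\<close>, for \<open>k \<in> K\<close>.
\<close>

definition interval_decomposition ::
  "('r::linorder, 'f::field, 'v::ab_group_add) pmod \<Rightarrow> 'k set \<Rightarrow>
    ('k \<Rightarrow> 'r cut) \<Rightarrow> ('k \<Rightarrow> 'r cut) \<Rightarrow> ('r \<Rightarrow> 'v \<Rightarrow> 'k \<Rightarrow> 'f) \<Rightarrow> bool" where
  "interval_decomposition A K b d \<alpha> \<longleftrightarrow>
     persistence_module A \<and> finite K \<and> (\<forall>k\<in>K. b k \<le> d k) \<and>
     pmod_iso A (direct_sum K (\<lambda>k. interval_module (b k) (d k))) \<alpha>"

definition has_barcode ::
  "('r::linorder, 'f::field, 'v::ab_group_add) pmod \<Rightarrow> 'k set \<Rightarrow>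
    ('k \<Rightarrow> 'r cut) \<Rightarrow> ('k \<Rightarrow> 'r cut) \<Rightarrow> bool" where
  "has_barcode A K b d \<longleftrightarrow> (\<exists>\<alpha>. interval_decomposition A K b d \<alpha>)"


subsection \<open>Matrices\<close>

text \<open>
  A matrix with rows indexed by \<open>I\<close> and columns indexed by \<open>J\<close> is a function \<open>'i \<Rightarrow> 'j \<Rightarrow> 'f\<close> of
  which only the entries in \<open>I \<times> J\<close> are meaningful, so restricting to a subset of the rows or
  columns does not change the function.
\<close>

definition mat_mul ::
  "'k set \<Rightarrow> ('i \<Rightarrow> 'k \<Rightarrow> 'f) \<Rightarrow> ('k \<Rightarrow> 'j \<Rightarrow> 'f) \<Rightarrow> 'i \<Rightarrow> 'j \<Rightarrow> 'f::comm_ring_1" where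
  "mat_mul K A B = (\<lambda>i j. \<Sum>k\<in>K. A i k * B k j)"

definition mat_transpose :: "('i \<Rightarrow> 'j \<Rightarrow> 'f) \<Rightarrow> 'j \<Rightarrow> 'i \<Rightarrow> 'f" where
  "mat_transpose A = (\<lambda>j i. A i j)"

definition id_mat :: "'k set \<Rightarrow> 'k \<Rightarrow> 'k \<Rightarrow> 'f::comm_ring_1" where
  "id_mat K = (\<lambda>i j. if i = j \<and> i \<in> K then 1 else 0)"

text \<open>For \<open>k \<noteq> l\<close>: multiplication on the right by this matrix adds \<open>a\<close> times column \<open>k\<close> to column \<open>l\<close>.\<close>

definition elem_mat :: "'k set \<Rightarrow> 'k \<Rightarrow> 'k \<Rightarrow> 'f \<Rightarrow> 'k \<Rightarrow> 'k \<Rightarrow> 'f::comm_ring_1" where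
  "elem_mat K k l a = (\<lambda>i j. id_mat K i j + (if i = k \<and> j = l then a else 0))"

text \<open>The entries outside \<open>K \<times> K\<close> are set to zero only to make the inverse unique as a function.\<close>

definition mat_inv :: "'k set \<Rightarrow> ('k \<Rightarrow> 'k \<Rightarrow> 'f) \<Rightarrow> 'k \<Rightarrow> 'k \<Rightarrow> 'f::comm_ring_1" where
  "mat_inv K A = (THE B.
     (\<forall>i j. i \<notin> K \<or> j \<notin> K \<longrightarrow> B i j = 0) \<and>
     (\<forall>i\<in>K. \<forall>j\<in>K. mat_mul K A B i j = id_mat K i j \<and> mat_mul K B A i j = id_mat K i j))"


subsection \<open>Matrix representations of morphisms\<close>

text \<open>
  \<open>A\<close> is decomposed by \<open>\<alpha>\<close> into bars from \<open>a' j\<close> to \<open>c' j\<close>, and \<open>B\<close> is decomposed by \<open>\<beta>\<close> into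
  bars from \<open>a i\<close> to \<open>c i\<close>; the predicate is meant for \<open>interval_decomposition A J a' c' \<alpha>\<close> and
  \<open>interval_decomposition B I a c \<beta>\<close>.
\<close>

definition represents ::
  "('r::linorder, 'f::field, 'v::ab_group_add) pmod \<Rightarrow> 'j set \<Rightarrow>
     ('j \<Rightarrow> 'r cut) \<Rightarrow> ('j \<Rightarrow> 'r cut) \<Rightarrow> ('r \<Rightarrow> 'v \<Rightarrow> 'j \<Rightarrow> 'f) \<Rightarrow>
   ('r, 'f, 'w::ab_group_add) pmod \<Rightarrow> 'i set \<Rightarrow>
     ('i \<Rightarrow> 'r cut) \<Rightarrow> ('i \<Rightarrow> 'r cut) \<Rightarrow> ('r \<Rightarrow> 'w \<Rightarrow> 'i \<Rightarrow> 'f) \<Rightarrow>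
   ('i \<Rightarrow> 'j \<Rightarrow> 'f) \<Rightarrow> ('r \<Rightarrow> 'v \<Rightarrow> 'w) \<Rightarrow> bool" where
  "represents A J a' c' \<alpha> B I a c \<beta> X \<phi> \<longleftrightarrow>
     pmod_hom A B \<phi> \<and>
     (\<forall>i\<in>I. \<forall>j\<in>J. a i > a' j \<or> c i > c' j \<longrightarrow> X i j = 0) \<and>
     (\<forall>i\<in>I. \<forall>j\<in>J. \<forall>t \<in> bar (a i) (c i) \<inter> bar (a' j) (c' j). \<forall>x.
        \<beta> t (\<phi> t (inv_into (space A t) (\<alpha> t) (\<lambda>k. if k = j then x else 0))) i = X i j * x)"


subsection \<open>Ordered reduction and pivots\<close>

text \<open>The orders on the index sets are those of the index types.\<close>

definition standard_orders ::
  "'j::linorder set \<Rightarrow> ('j \<Rightarrow> 'r::linorder cut) \<Rightarrow> 'i::linorder set \<Rightarrow> ('i \<Rightarrow> 'r cut) \<Rightarrow> bool" where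
  "standard_orders J b' I d \<longleftrightarrow>
     (\<forall>j\<in>J. \<forall>j'\<in>J. b' j < b' j' \<longrightarrow> j < j') \<and>
     (\<forall>i\<in>I. \<forall>i'\<in>I. d i > d i' \<longrightarrow> i < i')"

definition pivot_row :: "'i::linorder set \<Rightarrow> ('i \<Rightarrow> 'j \<Rightarrow> 'f::zero) \<Rightarrow> 'j \<Rightarrow> 'i" where
  "pivot_row I Y j = Min {i\<in>I. Y i j \<noteq> 0}"

text \<open>
  The state of the reduction is the product \<open>T\<close> of the elementary matrices used so far; the
  current matrix is \<open>XT\<close>.
\<close>

definition clear_column ::
  "'i::linorder set \<Rightarrow> 'j::linorder set \<Rightarrow> ('i \<Rightarrow> 'j \<Rightarrow> 'f::field) \<Rightarrow> 'i \<Rightarrow> 'j \<Rightarrow> 'j \<Rightarrow>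
    ('j \<Rightarrow> 'j \<Rightarrow> 'f) \<Rightarrow> 'j \<Rightarrow> 'j \<Rightarrow> 'f" where
  "clear_column I J X i j j' T =
     (let Y = mat_mul J X T in mat_mul J T (elem_mat J j j' (- Y i j' / Y i j)))"

definition process_column ::
  "'i::linorder set \<Rightarrow> 'j::linorder set \<Rightarrow> ('i \<Rightarrow> 'j \<Rightarrow> 'f::field) \<Rightarrow> 'j \<Rightarrow>
    ('j \<Rightarrow> 'j \<Rightarrow> 'f) \<Rightarrow> 'j \<Rightarrow> 'j \<Rightarrow> 'f" where
  "process_column I J X j T =
     (let Y = mat_mul J X T in
      if \<forall>i\<in>I. Y i j = 0 then T
      else fold (clear_column I J X (pivot_row I Y j) j) (sorted_list_of_set {j'\<in>J. j < j'}) T)"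

definition column_reducer ::
  "'i::linorder set \<Rightarrow> 'j::linorder set \<Rightarrow> ('i \<Rightarrow> 'j \<Rightarrow> 'f::field) \<Rightarrow> 'j \<Rightarrow> 'j \<Rightarrow> 'f" where
  "column_reducer I J X = fold (process_column I J X) (sorted_list_of_set J) (id_mat J)"

definition row_reducer ::
  "'i::linorder set \<Rightarrow> 'j::linorder set \<Rightarrow> ('i \<Rightarrow> 'j \<Rightarrow> 'f::field) \<Rightarrow> 'i \<Rightarrow> 'i \<Rightarrow> 'f" where
  "row_reducer I J X = mat_transpose (column_reducer J I (mat_transpose X))"

text \<open>
  Once a column has been processed it no longer changes, so the pivots met during the reduction
  are the first nonzero entries of the columns of the reduced matrix.
\<close>

definition pivots ::
  "'i::linorder set \<Rightarrow> 'j::linorder set \<Rightarrow> ('i \<Rightarrow> 'j \<Rightarrow> 'f::field) \<Rightarrow> ('i \<times> 'j) set" where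
  "pivots I J X =
     (let Y = mat_mul J X (column_reducer I J X) in
      {(pivot_row I Y j, j) | j. j \<in> J \<and> (\<exists>i\<in>I. Y i j \<noteq> 0)})"

definition nontrivial_pivots ::
  "'i::linorder set \<Rightarrow> ('i \<Rightarrow> 'r::linorder cut) \<Rightarrow> 'j::linorder set \<Rightarrow> ('j \<Rightarrow> 'r cut) \<Rightarrow>
    ('i \<Rightarrow> 'j \<Rightarrow> 'f::field) \<Rightarrow> ('i \<times> 'j) set" where
  "nontrivial_pivots I d J b' X = {(i, j) \<in> pivots I J X. b' j < d i}"

end

(*
  Write X = L M as a sum of rank one matrices, one for each pivot (i, j): a column of L with first
  nonzero entry in row i times a row of M with first nonzero entry in column j.  Such
  factorizations are X = S^-1 (SX) and X = (XT) T^-1 with the zero rows or columns of the reduced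
  matrix dropped.  Since distinct pivots lie in distinct rows and columns, no cancellation of
  leading entries occurs; hence the vanishing conditions that make X a morphism pass to L and M
  when the summand (i, j) is given birth b'_j and death d_i.  For the same reason, at each time L is
  injective and M surjective on the bars alive there, so the middle module is the image.
  S and T find the same pivots because the leading entries of the rows of SXT are those of SX, the
  leading entries of its columns are those of XT, and both families are without repetition.
*)
theory Submission
  imports Defs
begin

subsection \<open>Interval decompositions in coordinates\<close>

text \<open>The factorization \<open>X = L M\<close> runs over all pivots, trivial ones included. A
  pivot with \<open>d i \<le> b' j\<close> has an empty interval and is dropped only afterwards: at
  a time when row \<open>i\<close> and column \<open>j\<close> of \<open>X\<close> are both alive,
  every nonzero product \<open>L i k * M k j\<close> belongs to a pivot whose interval contains that
  time. The factorization of \<phi> is therefore checked time by time, on live rows and columns. A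
  nonzero entry of a factor needs two inequalities, and they come from different sources: one from
  the standard order, because the entry does not precede the leading one; the other from a nonzero
  entry of \<open>X\<close> produced by the absence of cancellation. Pivots are indexed by an
  abstract set with maps \<open>q\<close> and \<open>q'\<close> to rows and columns, so that one
  argument serves \<open>N\<close>, \<open>P\<^sub>I\<close> and \<open>P\<^sub>J\<close>.\<close>

definition alive :: "'k set \<Rightarrow> ('k \<Rightarrow> 'r::linorder cut) \<Rightarrow> ('k \<Rightarrow> 'r cut) \<Rightarrow> 'r \<Rightarrow> 'k set" where
  "alive K b d t = {k \<in> K. t \<in> bar (b k) (d k)}"

text \<open>The coordinate space F^A, encoded by functions on the whole index type; this is the
  shape of the spaces of \<open>direct_sum\<close>, and it gives the coordinate maps of all times
  one target type.\<close>

definition supported :: "'k set \<Rightarrow> ('k \<Rightarrow> 'f::zero) set" where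
  "supported A = {x. \<forall>k. k \<notin> A \<longrightarrow> x k = 0}"

definition apply_mat :: "'i set \<Rightarrow> 'j set \<Rightarrow> ('i \<Rightarrow> 'j \<Rightarrow> 'f) \<Rightarrow> ('j \<Rightarrow> 'f) \<Rightarrow> 'i \<Rightarrow> 'f::comm_ring_1" where
  "apply_mat A B X x = (\<lambda>i. if i \<in> A then \<Sum>j\<in>B. X i j * x j else 0)"

lemma down_mono: "c \<le> c' \<Longrightarrow> down c \<subseteq> down c'"
  by (simp add: less_eq_cut_def)

lemma up_antimono: "c \<le> c' \<Longrightarrow> up c' \<subseteq> up c"
  by (auto simp: less_eq_cut_def up_eq)

lemma down_closed: "s \<le> t \<Longrightarrow> t \<in> down c \<Longrightarrow> s \<in> down c"
  using down_less_up[of t c s] by (force simp: up_eq)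

lemma up_closed: "s \<le> t \<Longrightarrow> s \<in> up c \<Longrightarrow> t \<in> up c"
  using down_closed[of s t c] by (auto simp: up_eq)

lemma bar_nonempty: "t \<in> bar b d \<Longrightarrow> b < d"
  by (metis Compl_iff IntD1 IntD2 bar_def down_mono not_le_imp_less subsetD up_eq)

lemma aliveD:
  assumes "k \<in> alive K b d t"
  shows "k \<in> K" "t \<in> up (b k)" "t \<in> down (d k)"
  using assms by (auto simp: alive_def bar_def)

lemma aliveI: "k \<in> K \<Longrightarrow> t \<in> up (b k) \<Longrightarrow> t \<in> down (d k) \<Longrightarrow> k \<in> alive K b d t"
  by (auto simp: alive_def bar_def)

lemma alive_subset: "alive K b d t \<subseteq> K"
  by (auto simp: alive_def)

lemma finite_alive: "finite K \<Longrightarrow> finite (alive K b d t)"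
  by (simp add: alive_def)

lemma apply_mat_supported: "apply_mat A B X x \<in> supported A"
  by (simp add: apply_mat_def supported_def)

lemma apply_mat_add: "apply_mat A B X (x + y) = apply_mat A B X x + apply_mat A B X y"
  by (rule ext) (simp add: apply_mat_def sum.distrib algebra_simps)

lemma apply_mat_scale: "apply_mat A B X (\<lambda>k. a * x k) = (\<lambda>k. a * apply_mat A B X x k)"
  by (rule ext) (simp add: apply_mat_def sum_distrib_left algebra_simps)

lemma apply_mat_single:
  "finite B \<Longrightarrow> j \<in> B \<Longrightarrow> i \<in> A \<Longrightarrow> apply_mat A B X (\<lambda>k. if k = j then x else 0) i = X i j * x"
  by (simp add: apply_mat_def if_distrib sum.delta cong: if_cong)

lemma single_supported: "j \<in> B \<Longrightarrow> (\<lambda>k. if k = j then x else 0) \<in> supported B"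
  by (auto simp: supported_def)

lemma add_supported: "x \<in> supported A \<Longrightarrow> y \<in> supported A \<Longrightarrow> (x + y :: _ \<Rightarrow> 'f::comm_ring_1) \<in> supported A"
  by (auto simp: supported_def)

lemma scale_supported: "x \<in> supported A \<Longrightarrow> (\<lambda>k. a * x k :: 'f::comm_ring_1) \<in> supported A"
  by (auto simp: supported_def)

lemma direct_sum_interval_space:
  assumes "finite K"
  shows "space (direct_sum K (\<lambda>k. interval_module (b k) (d k))) t
    = (supported (alive K b d t) :: ('k \<Rightarrow> 'f::field) set)"
proof -
  have "finite {k. x k \<noteq> 0}" if "\<forall>k. k \<notin> K \<longrightarrow> x k = 0" for x :: "'k \<Rightarrow> 'f"
    using finite_subset[OF _ assms, of "{k. x k \<noteq> 0}"] that by blast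
  then show ?thesis
    by (auto simp: direct_sum_def interval_module_def supported_def alive_def split: if_splits)
qed

text \<open>Reads a decomposition as a family of linear coordinate isomorphisms; a structure map
  keeps exactly the coordinates alive at both times. The mapping clause of
  \<open>linear_between\<close> is absorbed into the bijection.\<close>

lemma interval_decomposition_iff:
  "interval_decomposition A K b d \<alpha> \<longleftrightarrow>
    persistence_module A \<and> finite K \<and> (\<forall>k\<in>K. b k \<le> d k) \<and>
    (\<forall>t. bij_betw (\<alpha> t) (space A t) (supported (alive K b d t))) \<and>
    (\<forall>t. \<forall>x\<in>space A t. \<forall>y\<in>space A t. \<alpha> t (x + y) = \<alpha> t x + \<alpha> t y) \<and>
    (\<forall>t a. \<forall>x\<in>space A t. \<alpha> t (smul A a x) = (\<lambda>k. a * \<alpha> t x k)) \<and>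
    (\<forall>s t. s \<le> t \<longrightarrow> (\<forall>x\<in>space A s. \<alpha> t (trans A s t x) =
       (\<lambda>k. if k \<in> alive K b d s \<and> k \<in> alive K b d t then \<alpha> s x k else 0)))"
    (is "_ \<longleftrightarrow> ?R")
proof -
  let ?D = "direct_sum K (\<lambda>k. interval_module (b k) (d k)) :: ('a, 'b, 'd \<Rightarrow> 'b) pmod"
  have sm: "smul ?D a x = (\<lambda>k. a * x k)" for a x
    by (simp add: direct_sum_def interval_module_def)
  have tr: "trans ?D s t x = (\<lambda>k. if k \<in> alive K b d s \<and> k \<in> alive K b d t then x k else 0)" for s t x
    by (rule ext) (simp add: direct_sum_def interval_module_def alive_def)
  \<comment> \<open>The inclusions implied by bijectivity are added so that the right side unfolds
    to the same clauses as \<open>pmod_hom\<close>.\<close>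
  have image: "(\<forall>t. bij_betw (\<alpha> t) (space A t) (supported (alive K b d t))) \<longleftrightarrow>
    (\<forall>t. \<alpha> t ` space A t \<subseteq> supported (alive K b d t)) \<and>
    (\<forall>t. bij_betw (\<alpha> t) (space A t) (supported (alive K b d t)))"
    by (auto simp: bij_betw_def)
  show ?thesis
    by (subst image) (auto simp: interval_decomposition_def pmod_iso_def pmod_hom_def
        linear_between_def sm tr direct_sum_interval_space image_subset_iff)
qed

lemma interval_decompositionD:
  assumes "interval_decomposition A K b d \<alpha>"
  shows "persistence_module A" "finite K" "k \<in> K \<Longrightarrow> b k \<le> d k"
    "bij_betw (\<alpha> t) (space A t) (supported (alive K b d t))"
    "x \<in> space A t \<Longrightarrow> y \<in> space A t \<Longrightarrow> \<alpha> t (x + y) = \<alpha> t x + \<alpha> t y"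
    "x \<in> space A t \<Longrightarrow> \<alpha> t (smul A a x) = (\<lambda>k. a * \<alpha> t x k)"
    "s \<le> t \<Longrightarrow> x \<in> space A s \<Longrightarrow> \<alpha> t (trans A s t x) =
       (\<lambda>k. if k \<in> alive K b d s \<and> k \<in> alive K b d t then \<alpha> s x k else 0)"
  using assms unfolding interval_decomposition_iff by simp_all

text \<open>\<open>represents\<close> prescribes \<phi> only on single coordinates and only between
  bars alive at the same time. Additivity extends this to the whole space, since each vector is a
  finite sum of multiples of live coordinate vectors.\<close>

lemma represents_coordinates:
  fixes U :: "('r::linorder, 'f::field, 'u::ab_group_add) pmod"
    and V :: "('r, 'f, 'v::ab_group_add) pmod"
  assumes U: "interval_decomposition U J b' d' \<alpha>"
    and V: "interval_decomposition V I b d \<beta>"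
    and X: "represents U J b' d' \<alpha> V I b d \<beta> X \<phi>"
    and u: "u \<in> space U t"
  shows "\<beta> t (\<phi> t u) = apply_mat (alive I b d t) (alive J b' d' t) X (\<alpha> t u)"
proof -
  note U' = interval_decompositionD[OF U] and V' = interval_decompositionD[OF V]
  define It Jt where "It = alive I b d t" and "Jt = alive J b' d' t"
  have finJ: "finite Jt"
    using U' by (simp add: Jt_def finite_alive)
  have bij: "bij_betw (\<alpha> t) (space U t) (supported Jt)"
    using U' by (simp add: Jt_def)
  define ai where "ai = inv_into (space U t) (\<alpha> t)"
  have ai: "ai x \<in> space U t" "\<alpha> t (ai x) = x" if "x \<in> supported Jt" for x
    using that bij unfolding ai_def
    by (auto simp: bij_betw_def inv_into_into f_inv_into_f)
  have ai_\<alpha>: "ai (\<alpha> t w) = w" if "w \<in> space U t" for w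
    using that bij by (simp add: ai_def bij_betw_def)
  have hom: "linear_between (smul U) (space U t) (smul V) (space V t) (\<phi> t)"
    using X by (simp add: represents_def pmod_hom_def)
  have ph: "\<phi> t w \<in> space V t" if "w \<in> space U t" for w
    using hom that by (simp add: linear_between_def image_subset_iff)
  have subU: "module.subspace (smul U) (space U t)" "vector_space (smul U)"
    using U' by (auto simp: persistence_module_def)
  interpret vector_space "smul U" by (rule subU)
  have plusU: "w + w' \<in> space U t" if "w \<in> space U t" "w' \<in> space U t" for w w'
    using subU that by (simp add: subspace_add)
  have plus\<alpha>: "\<alpha> t (w + w') = \<alpha> t w + \<alpha> t w'" if "w \<in> space U t" "w' \<in> space U t" for w w'
    by (rule U'(5)[OF that])
  define f where "f x = \<beta> t (\<phi> t (ai x))" for x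
  have f_add: "f (x + y) = f x + f y" if "x \<in> supported Jt" "y \<in> supported Jt" for x y
  proof -
    have "ai (x + y) = ai (\<alpha> t (ai x + ai y))"
      using that ai plus\<alpha> by simp
    also have "\<dots> = ai x + ai y"
      using that ai plusU by (intro ai_\<alpha>) auto
    finally show ?thesis
      using V' hom ai that ph by (simp add: f_def linear_between_def)
  qed
  have f_supp: "f x \<in> supported It" if "x \<in> supported Jt" for x
  proof -
    have "\<beta> t ` space V t = supported It"
      using V' by (auto simp: It_def bij_betw_def)
    then show ?thesis
      using ph ai that by (auto simp: f_def)
  qed
  have single: "f (\<lambda>k. if k = j then x else 0) = apply_mat It Jt X (\<lambda>k. if k = j then x else 0)"
    if j: "j \<in> Jt" for j x
  proof
    fix i
    show "f (\<lambda>k. if k = j then x else 0) i = apply_mat It Jt X (\<lambda>k. if k = j then x else 0) i"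
    proof (cases "i \<in> It")
      case True
      then show ?thesis
        using X j finJ by (auto simp: represents_def f_def ai_def apply_mat_single It_def Jt_def alive_def)
    next
      case False
      then show ?thesis
        using f_supp[OF single_supported[OF j]] by (simp add: supported_def apply_mat_def)
    qed
  qed
  \<comment> \<open>Induction on a set \<open>B\<close> containing the support, splitting off one
    coordinate at a time; \<open>single\<close> already allows an arbitrary coefficient.\<close>
  have f_eq: "f x = apply_mat It Jt X x" if "x \<in> supported B" "B \<subseteq> Jt" for x B
  proof -
    have "finite B"
      using finJ that finite_subset by blast
    then show ?thesis
      using that
    proof (induction B arbitrary: x rule: finite_induct)
      case empty
      then have "x = 0" by (auto simp: supported_def)
      moreover have "f 0 = 0"
        using f_add[of 0 0] by (simp add: supported_def)
      moreover have "apply_mat It Jt X 0 = 0"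
        by (auto simp: apply_mat_def)
      ultimately show ?case by metis
    next
      case (insert j B)
      define y z where "y = (\<lambda>k. if k = j then x j else 0)" and "z = x(j := 0)"
      have x: "x = y + z"
        by (auto simp: y_def z_def)
      have z: "z \<in> supported B"
        using insert.prems by (auto simp: z_def supported_def)
      have ys: "y \<in> supported Jt" and zs: "z \<in> supported Jt"
        using z insert.prems by (auto simp: y_def supported_def)
      have "f y = apply_mat It Jt X y"
        using single insert.prems by (simp add: y_def)
      moreover have "f z = apply_mat It Jt X z"
        using insert.IH[OF z] insert.prems by simp
      ultimately show ?case
        using f_add[OF ys zs] apply_mat_add[of It Jt X y z] by (simp only: x[symmetric])
    qed
  qed
  have "\<alpha> t u \<in> supported Jt"
    using bij u by (auto simp: bij_betw_def)
  then show ?thesis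
    using f_eq[of "\<alpha> t u" Jt] u by (simp add: f_def ai_\<alpha> It_def Jt_def)
qed

section \<open>The image of a morphism and its decomposition\<close>

lemma persistence_module_image:
  fixes U :: "('r::linorder, 'f::field, 'u::ab_group_add) pmod"
    and V :: "('r, 'f, 'v::ab_group_add) pmod"
  assumes U: "persistence_module U" and V: "persistence_module V" and \<phi>: "pmod_hom U V \<phi>"
  shows "persistence_module (pmod_image U V \<phi>)"
proof -
  have sub: "\<phi> t ` space U t \<subseteq> space V t" for t
    using \<phi> by (simp add: pmod_hom_def linear_between_def)
  have plus: "\<phi> t (x + y) = \<phi> t x + \<phi> t y" if "x \<in> space U t" "y \<in> space U t" for t x y
    using \<phi> that by (simp add: pmod_hom_def linear_between_def)
  have scale: "\<phi> t (smul U a x) = smul V a (\<phi> t x)" if "x \<in> space U t" for t x a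
    using \<phi> that by (simp add: pmod_hom_def linear_between_def)
  have nat: "trans V s t (\<phi> s x) = \<phi> t (trans U s t x)" if "s \<le> t" "x \<in> space U s" for s t x
    using \<phi> that by (simp add: pmod_hom_def)
  interpret vU: vector_space "smul U" using U by (simp add: persistence_module_def)
  interpret vV: vector_space "smul V" using V by (simp add: persistence_module_def)
  have sU: "vU.subspace (space U t)" for t
    using U by (simp add: persistence_module_def)
  have subspace: "vV.subspace (\<phi> t ` space U t)" for t
  proof (rule vV.subspaceI)
    have "\<phi> t 0 = 0"
      using plus[of 0 t 0] vU.subspace_0[OF sU] by simp
    then show "0 \<in> \<phi> t ` space U t"
      using vU.subspace_0[OF sU, of t] by (metis imageI)
  next
    fix x y assume "x \<in> \<phi> t ` space U t" "y \<in> \<phi> t ` space U t"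
    then obtain x' y' where "x = \<phi> t x'" "y = \<phi> t y'" "x' \<in> space U t" "y' \<in> space U t" by blast
    then show "x + y \<in> \<phi> t ` space U t"
      using plus[symmetric] vU.subspace_add[OF sU] by simp
  next
    fix a x assume "x \<in> \<phi> t ` space U t"
    then obtain x' where "x = \<phi> t x'" "x' \<in> space U t" by blast
    then show "smul V a x \<in> \<phi> t ` space U t"
      using scale[symmetric] vU.subspace_scale[OF sU] by simp
  qed
  have lin: "linear_between (smul V) (\<phi> s ` space U s) (smul V) (\<phi> t ` space U t) (trans V s t)"
    if "s \<le> t" for s t
  proof -
    have "linear_between (smul V) (space V s) (smul V) (space V t) (trans V s t)"
      using V that by (simp add: persistence_module_def)
    moreover have "trans U s t ` space U s \<subseteq> space U t"
      using U that by (simp add: persistence_module_def linear_between_def)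
    then have "trans V s t ` (\<phi> s ` space U s) \<subseteq> \<phi> t ` space U t"
      by (auto simp: nat[OF that])
    ultimately show ?thesis
      using subsetD[OF sub] unfolding linear_between_def by blast
  qed
  show ?thesis
    using V sub subspace lin vV.vector_space_axioms
    unfolding persistence_module_def pmod_image_def by (simp add: subset_iff) 
qed

text \<open>
  If the matrix of \<open>\<phi>\<close> factors at every time as \<open>L M\<close> with \<open>L\<close> injective and \<open>M\<close> surjective, then \<open>L\<close>
  identifies the middle module with the image.
\<close>

lemma image_decomposition:
  fixes U :: "('r::linorder, 'f::field, 'u::ab_group_add) pmod"
    and V :: "('r, 'f, 'v::ab_group_add) pmod"
  assumes U: "interval_decomposition U J b' d' \<alpha>"
    and V: "interval_decomposition V I b d \<beta>"
    and X: "represents U J b' d' \<alpha> V I b d \<beta> X \<phi>"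
    and K: "finite K" "\<And>k. k \<in> K \<Longrightarrow> e k \<le> f k"
    and M: "\<And>k j. k \<in> K \<Longrightarrow> j \<in> J \<Longrightarrow> M k j \<noteq> 0 \<Longrightarrow> e k \<le> b' j \<and> f k \<le> d' j"
    and L: "\<And>i k. i \<in> I \<Longrightarrow> k \<in> K \<Longrightarrow> L i k \<noteq> 0 \<Longrightarrow> b i \<le> e k \<and> d i \<le> f k"
    and comp: "\<And>t i j. i \<in> alive I b d t \<Longrightarrow> j \<in> alive J b' d' t \<Longrightarrow>
      X i j = (\<Sum>k\<in>alive K e f t. L i k * M k j)"
    and surj: "\<And>t y. \<exists>x\<in>supported (alive J b' d' t). \<forall>k\<in>alive K e f t.
      (\<Sum>j\<in>alive J b' d' t. M k j * x j) = y k"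
    and inj: "\<And>t x. \<forall>i\<in>alive I b d t. (\<Sum>k\<in>alive K e f t. L i k * x k) = 0 \<Longrightarrow>
      \<forall>k\<in>alive K e f t. x k = 0"
  shows "\<exists>\<gamma>. interval_decomposition (pmod_image U V \<phi>) K e f \<gamma>
     \<and> represents U J b' d' \<alpha> (pmod_image U V \<phi>) K e f \<gamma> M \<phi>
     \<and> represents (pmod_image U V \<phi>) K e f \<gamma> V I b d \<beta> L (\<lambda>t v. v)"
proof -
  note U' = interval_decompositionD[OF U] and V' = interval_decompositionD[OF V]
  let ?im = "pmod_image U V \<phi>"
  define It where "It t = alive I b d t" for t
  define Jt where "Jt t = alive J b' d' t" for t
  define Kt where "Kt t = alive K e f t" for t
  define Lt where "Lt t = apply_mat (It t) (Kt t) L" for t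
  define Mt where "Mt t = apply_mat (Kt t) (Jt t) M" for t
  have hom: "pmod_hom U V \<phi>"
    using X by (simp add: represents_def)
  have \<phi>V: "\<phi> t u \<in> space V t" if "u \<in> space U t" for t u
    using hom that by (simp add: pmod_hom_def linear_between_def image_subset_iff)
  have \<alpha>bij: "bij_betw (\<alpha> t) (space U t) (supported (Jt t))" for t
    using U' by (simp add: Jt_def)
  have \<beta>bij: "bij_betw (\<beta> t) (space V t) (supported (It t))" for t
    using V' by (simp add: It_def)
  have fin: "finite (It t)" "finite (Jt t)" "finite (Kt t)" for t
    using U' V' K by (simp_all add: It_def Jt_def Kt_def finite_alive)
  have Lt_inj: "x = y" if "Lt t x = Lt t y" "x \<in> supported (Kt t)" "y \<in> supported (Kt t)" for t x y
  proof -
    have "(\<Sum>k\<in>Kt t. L i k * (x k - y k)) = 0" if "i \<in> It t" for i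
      using fun_cong[OF \<open>Lt t x = Lt t y\<close>, of i] that
      by (simp add: Lt_def apply_mat_def algebra_simps sum_subtractf)
    then have "\<forall>k\<in>Kt t. x k - y k = 0"
      unfolding It_def Kt_def by (intro inj) blast
    then show ?thesis
      using that by (fastforce simp: supported_def)
  qed
  have LtMt: "\<beta> t (\<phi> t u) = Lt t (Mt t (\<alpha> t u))" if "u \<in> space U t" for t u
  proof -
    have "(\<Sum>j\<in>Jt t. X i j * \<alpha> t u j) = (\<Sum>k\<in>Kt t. L i k * Mt t (\<alpha> t u) k)" if i: "i \<in> It t" for i
    proof -
      have "(\<Sum>j\<in>Jt t. X i j * \<alpha> t u j) = (\<Sum>j\<in>Jt t. \<Sum>k\<in>Kt t. L i k * (M k j * \<alpha> t u j))"
        using comp[of i t] i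
        by (intro sum.cong) (simp_all add: It_def Jt_def Kt_def sum_distrib_right mult.assoc)
      also have "\<dots> = (\<Sum>k\<in>Kt t. L i k * (\<Sum>j\<in>Jt t. M k j * \<alpha> t u j))"
        by (subst sum.swap) (simp add: sum_distrib_left)
      also have "\<dots> = (\<Sum>k\<in>Kt t. L i k * Mt t (\<alpha> t u) k)"
        by (intro sum.cong) (simp_all add: Mt_def apply_mat_def)
      finally show ?thesis .
    qed
    then show ?thesis
      using represents_coordinates[OF U V X that]
      by (auto simp: Lt_def It_def[symmetric] Jt_def[symmetric] apply_mat_def)
  qed
  \<comment> \<open>Coordinates on the image are found by solving through the injective
    \<open>L\<close>, not by choosing a preimage in \<open>U\<close>, so independence of the
    preimage is automatic. A solution exists on the image by \<open>LtMt\<close>.\<close>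
  define \<gamma> where "\<gamma> t v = (THE x. x \<in> supported (Kt t) \<and> \<beta> t v = Lt t x)" for t v
  have \<gamma>I: "\<gamma> t v = x" if "x \<in> supported (Kt t)" "\<beta> t v = Lt t x" for t v x
    unfolding \<gamma>_def using that Lt_inj by (intro the_equality) auto
  have \<gamma>\<phi>: "\<gamma> t (\<phi> t u) = Mt t (\<alpha> t u)" if "u \<in> space U t" for t u
    using LtMt[OF that] by (intro \<gamma>I) (simp_all add: Mt_def apply_mat_supported)
  have im_space: "space ?im t = \<phi> t ` space U t" for t
    by (simp add: pmod_image_def)
  have im_simps: "smul ?im = smul V" "trans ?im = trans V"
    by (simp_all add: pmod_image_def)
  have imV: "v \<in> space V t" if "v \<in> space ?im t" for v t
    using that \<phi>V by (auto simp: im_space)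
  have \<gamma>supp: "\<gamma> t v \<in> supported (Kt t)" and \<beta>\<gamma>: "\<beta> t v = Lt t (\<gamma> t v)"
    if "v \<in> space ?im t" for t v
    using that \<gamma>\<phi> LtMt by (auto simp: im_space Mt_def apply_mat_supported)
  have pm: "persistence_module ?im"
    by (rule persistence_module_image[OF U'(1) V'(1) hom])
  have \<gamma>bij: "bij_betw (\<gamma> t) (space ?im t) (supported (Kt t))" for t
  proof -
    have "inj_on (\<gamma> t) (space ?im t)"
    proof (rule inj_onI)
      fix v w assume vw: "v \<in> space ?im t" "w \<in> space ?im t" and "\<gamma> t v = \<gamma> t w"
      then have "\<beta> t v = \<beta> t w"
        by (simp add: \<beta>\<gamma>)
      then show "v = w"
        using inj_onD[OF bij_betw_imp_inj_on[OF \<beta>bij]] imV vw by simp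
    qed
    moreover have "supported (Kt t) \<subseteq> \<gamma> t ` space ?im t"
    proof
      fix y :: "'c \<Rightarrow> 'f" assume y: "y \<in> supported (Kt t)"
      obtain x where x: "x \<in> supported (Jt t)" "\<forall>k\<in>Kt t. (\<Sum>j\<in>Jt t. M k j * x j) = y k"
        using surj[of t y] by (auto simp: Jt_def Kt_def)
      have "x \<in> \<alpha> t ` space U t"
        using x \<alpha>bij[of t] by (simp add: bij_betw_def)
      then obtain u where u: "u \<in> space U t" "\<alpha> t u = x"
        by blast
      have "\<gamma> t (\<phi> t u) = y"
        using x y u by (auto simp: \<gamma>\<phi> Mt_def apply_mat_def supported_def)
      then show "y \<in> \<gamma> t ` space ?im t"
        using u by (auto simp: im_space)
    qed
    ultimately show ?thesis
      using \<gamma>supp by (auto simp: bij_betw_def)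
  qed
  have \<gamma>trans: "\<gamma> t (trans V s t v) = (\<lambda>k. if k \<in> Kt s \<and> k \<in> Kt t then \<gamma> s v k else 0)"
    if st: "s \<le> t" and v: "v \<in> space ?im s" for s t v
  proof (rule \<gamma>I)
    let ?x = "\<lambda>k. if k \<in> Kt s \<and> k \<in> Kt t then \<gamma> s v k else 0"
    show "?x \<in> supported (Kt t)"
      by (auto simp: supported_def)
    show "\<beta> t (trans V s t v) = Lt t ?x"
    proof
      fix i
      have lhs: "\<beta> t (trans V s t v) i = (if i \<in> It s \<and> i \<in> It t then \<beta> s v i else 0)"
        using V' st imV[OF v] by (simp add: It_def)
      show "\<beta> t (trans V s t v) i = Lt t ?x i"
      proof (cases "i \<in> It t")
        case False
        then show ?thesis by (auto simp: lhs Lt_def apply_mat_def)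
      next
        case True
        have iI: "i \<in> I" "t \<in> up (b i)" "t \<in> down (d i)"
          using True aliveD unfolding It_def by metis+
        have Lt: "Lt t ?x i = (\<Sum>k\<in>Kt s \<inter> Kt t. L i k * \<gamma> s v k)"
        proof -
          have "Lt t ?x i = (\<Sum>k\<in>Kt t. L i k * ?x k)"
            using True by (simp add: Lt_def apply_mat_def)
          also have "\<dots> = (\<Sum>k\<in>Kt s \<inter> Kt t. L i k * ?x k)"
            using fin by (intro sum.mono_neutral_right) auto
          finally show ?thesis by simp
        qed
        show ?thesis
        proof (cases "i \<in> It s")
          case s: True
          \<comment> \<open>\<open>L i k \<noteq> 0\<close> forces \<open>d i \<le> f k\<close>: a
            bar \<open>k\<close> alive at \<open>s\<close> lasts at least as long as row
            \<open>i\<close>, which is alive at \<open>t\<close>.\<close>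
          have "k \<in> Kt t" if k: "k \<in> Kt s" "L i k \<noteq> 0" for k
          proof -
            have kK: "k \<in> K" "s \<in> up (e k)"
              using k aliveD unfolding Kt_def by metis+
            then have "t \<in> down (f k)"
              using L[OF iI(1) kK(1) k(2)] iI down_mono by blast
            then show ?thesis
              using kK up_closed[OF st] by (auto simp: Kt_def intro: aliveI)
          qed
          then have "(\<Sum>k\<in>Kt s \<inter> Kt t. L i k * \<gamma> s v k) = (\<Sum>k\<in>Kt s. L i k * \<gamma> s v k)"
            using fin by (intro sum.mono_neutral_left) auto
          then show ?thesis
            using s True by (simp add: lhs Lt \<beta>\<gamma>[OF v]) (simp add: Lt_def apply_mat_def)
        next
          case False
          \<comment> \<open>Row \<open>i\<close> is born after \<open>s\<close> here. A bar
            \<open>k\<close> alive at \<open>s\<close> with \<open>L i k \<noteq> 0\<close> would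
            give \<open>b i \<le> e k\<close> and make \<open>i\<close> alive at
            \<open>s\<close>.\<close>
          have "L i k = 0" if k: "k \<in> Kt s" for k
          proof (rule ccontr)
            assume nz: "L i k \<noteq> 0"
            have kK: "k \<in> K" "s \<in> up (e k)"
              using k aliveD unfolding Kt_def by metis+
            then have "s \<in> up (b i)"
              using L[OF iI(1) kK(1) nz] up_antimono by blast
            then have "i \<in> It s"
              using iI down_closed[OF st] by (auto simp: It_def intro: aliveI)
            with False show False by simp
          qed
          then show ?thesis
            using False by (simp add: lhs Lt)
        qed
      qed
    qed
  qed
  have dec: "interval_decomposition ?im K e f \<gamma>"
    unfolding interval_decomposition_iff Kt_def[symmetric] im_simps
  proof (intro conjI allI impI ballI)
    fix t x y assume "x \<in> space ?im t" "y \<in> space ?im t"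
    then show "\<gamma> t (x + y) = \<gamma> t x + \<gamma> t y"
      using V' imV \<beta>\<gamma> \<gamma>supp
      by (intro \<gamma>I add_supported) (simp_all add: Lt_def apply_mat_add)
  next
    fix t a x assume x: "x \<in> space ?im t"
    then have "\<beta> t (smul V a x) = (\<lambda>k. a * \<beta> t x k)"
      by (intro V'(6) imV)
    then show "\<gamma> t (smul V a x) = (\<lambda>k. a * \<gamma> t x k)"
      using \<beta>\<gamma>[OF x] \<gamma>supp[OF x]
      by (intro \<gamma>I scale_supported) (simp_all add: Lt_def apply_mat_scale)
  qed (use pm K \<gamma>bij \<gamma>trans in auto)
  have rep1: "represents U J b' d' \<alpha> ?im K e f \<gamma> M \<phi>"
    unfolding represents_def
  proof (intro conjI ballI allI impI)
    show "pmod_hom U ?im \<phi>"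
      using hom by (auto simp: pmod_hom_def linear_between_def pmod_image_def)
  next
    fix k j assume "k \<in> K" "j \<in> J" "e k > b' j \<or> f k > d' j"
    then show "M k j = 0"
      using M[of k j] by (auto simp: not_le[symmetric])
  next
    fix k j t and x :: 'f assume "k \<in> K" "j \<in> J" "t \<in> bar (e k) (f k) \<inter> bar (b' j) (d' j)"
    then have kj: "k \<in> Kt t" "j \<in> Jt t"
      by (auto simp: Kt_def Jt_def alive_def)
    let ?y = "\<lambda>k. if k = j then x else 0"
    have "?y \<in> \<alpha> t ` space U t"
      using \<alpha>bij[of t] single_supported[OF kj(2)] by (simp add: bij_betw_def)
    then have "inv_into (space U t) (\<alpha> t) ?y \<in> space U t" "\<alpha> t (inv_into (space U t) (\<alpha> t) ?y) = ?y"
      by (auto simp: inv_into_into f_inv_into_f)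
    then show "\<gamma> t (\<phi> t (inv_into (space U t) (\<alpha> t) ?y)) k = M k j * x"
      using kj fin by (simp add: \<gamma>\<phi> Mt_def apply_mat_single)
  qed
  have rep2: "represents ?im K e f \<gamma> V I b d \<beta> L (\<lambda>t v. v)"
    unfolding represents_def
  proof (intro conjI ballI allI impI)
    show "pmod_hom ?im V (\<lambda>t v. v)"
      using imV by (auto simp: pmod_hom_def linear_between_def im_simps)
  next
    fix i k assume "i \<in> I" "k \<in> K" "b i > e k \<or> d i > f k"
    then show "L i k = 0"
      using L[of i k] by (auto simp: not_le[symmetric])
  next
    fix i k t and x :: 'f assume "i \<in> I" "k \<in> K" "t \<in> bar (b i) (d i) \<inter> bar (e k) (f k)"
    then have ik: "k \<in> Kt t" "i \<in> It t"
      by (auto simp: Kt_def It_def alive_def)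
    let ?y = "\<lambda>l. if l = k then x else 0"
    have "?y \<in> \<gamma> t ` space ?im t"
      using \<gamma>bij[of t] single_supported[OF ik(1)] by (simp add: bij_betw_def)
    then have "inv_into (space ?im t) (\<gamma> t) ?y \<in> space ?im t" "\<gamma> t (inv_into (space ?im t) (\<gamma> t) ?y) = ?y"
      by (auto simp: inv_into_into f_inv_into_f)
    then show "\<beta> t (inv_into (space ?im t) (\<gamma> t) ?y) i = L i k * x"
      using ik fin by (simp add: \<beta>\<gamma> Lt_def apply_mat_single)
  qed
  show ?thesis
    using dec rep1 rep2 by blast
qed

subsection \<open>Ordered reduction\<close>

text \<open>With zeros forced outside \<open>K\<close>, matrix identities become equalities of
  functions; \<open>mat_inv\<close> is normalised in the same way.\<close>

definition zero_outside :: "'k set \<Rightarrow> ('k \<Rightarrow> 'k \<Rightarrow> 'f::zero) \<Rightarrow> bool" where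
  "zero_outside K A \<longleftrightarrow> (\<forall>i j. i \<notin> K \<or> j \<notin> K \<longrightarrow> A i j = 0)"

definition unitriangular :: "'k::linorder set \<Rightarrow> ('k \<Rightarrow> 'k \<Rightarrow> 'f::field) \<Rightarrow> bool" where
  "unitriangular K A \<longleftrightarrow> zero_outside K A \<and> (\<forall>i\<in>K. A i i = 1) \<and> (\<forall>i j. j < i \<longrightarrow> A i j = 0)"

section \<open>Algebra of unitriangular matrices\<close>

lemma mat_mul_assoc:
  "mat_mul L (mat_mul K A B) C = mat_mul K A (mat_mul L B C)"
proof (intro ext)
  fix i j
  have "mat_mul L (mat_mul K A B) C i j = (\<Sum>l\<in>L. \<Sum>k\<in>K. A i k * (B k l * C l j))"
    by (simp add: mat_mul_def sum_distrib_right mult.assoc)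
  also have "\<dots> = mat_mul K A (mat_mul L B C) i j"
    by (subst sum.swap) (simp add: mat_mul_def sum_distrib_left)
  finally show "mat_mul L (mat_mul K A B) C i j = mat_mul K A (mat_mul L B C) i j" .
qed

lemma mat_mul_id_right:
  "finite K \<Longrightarrow> j \<in> K \<Longrightarrow> mat_mul K A (id_mat K) i j = A i j"
  by (simp add: mat_mul_def id_mat_def if_distrib sum.delta' cong: if_cong conj_cong)

lemma mat_mul_id_left:
  "finite K \<Longrightarrow> i \<in> K \<Longrightarrow> mat_mul K (id_mat K) A i j = A i j"
  by (simp add: mat_mul_def id_mat_def if_distrib[of "\<lambda>x. x * _"] sum.delta cong: if_cong conj_cong)

lemma mat_mul_id_zero_outside:
  assumes "finite K" "zero_outside K A"
  shows "mat_mul K A (id_mat K) = A" "mat_mul K (id_mat K) A = A"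
proof -
  show "mat_mul K A (id_mat K) = A"
  proof (intro ext)
    fix i j show "mat_mul K A (id_mat K) i j = A i j"
      using assms by (cases "j \<in> K") (simp_all add: mat_mul_id_right zero_outside_def, auto simp: mat_mul_def id_mat_def intro!: sum.neutral)
  qed
  show "mat_mul K (id_mat K) A = A"
  proof (intro ext)
    fix i j show "mat_mul K (id_mat K) A i j = A i j"
      using assms by (cases "i \<in> K") (simp_all add: mat_mul_id_left zero_outside_def, auto simp: mat_mul_def id_mat_def intro!: sum.neutral)
  qed
qed

text \<open>The first summand is \<open>A i j\<close> for \<open>j \<in> K\<close> and zero
  otherwise; leaving it as a product keeps the formula valid for rectangular
  \<open>A\<close>.\<close>

lemma mat_mul_elem:
  assumes "finite K" "k \<in> K" "l \<in> K"
  shows "mat_mul K A (elem_mat K k l a) i j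
    = mat_mul K A (id_mat K) i j + (if j = l then a * A i k else 0)"
proof -
  have "mat_mul K A (elem_mat K k l a) i j
      = mat_mul K A (id_mat K) i j + (\<Sum>m\<in>K. if m = k then (if j = l then a * A i k else 0) else 0)"
    unfolding mat_mul_def elem_mat_def sum.distrib[symmetric]
    by (intro sum.cong) (auto simp: algebra_simps)
  then show ?thesis
    using assms by (simp add: sum.delta)
qed

lemma mat_mul_zero_outside:
  "zero_outside K A \<Longrightarrow> zero_outside K B \<Longrightarrow> zero_outside K (mat_mul K A B)"
  by (auto simp: zero_outside_def mat_mul_def intro!: sum.neutral)

lemma unitriangular_id: "unitriangular K (id_mat K)"
  by (auto simp: unitriangular_def zero_outside_def id_mat_def)

lemma unitriangular_elem: "k \<in> K \<Longrightarrow> l \<in> K \<Longrightarrow> k < l \<Longrightarrow> unitriangular K (elem_mat K k l a)"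
  by (auto simp: unitriangular_def zero_outside_def elem_mat_def id_mat_def)

lemma unitriangular_mul:
  fixes A B :: "'k::linorder \<Rightarrow> 'k \<Rightarrow> 'f::field"
  assumes K: "finite K" and A: "unitriangular K A" and B: "unitriangular K B"
  shows "unitriangular K (mat_mul K A B)"
  unfolding unitriangular_def
proof (intro conjI ballI allI impI)
  show "zero_outside K (mat_mul K A B)"
    using A B by (simp add: unitriangular_def mat_mul_zero_outside)
next
  fix i assume i: "i \<in> K"
  have "mat_mul K A B i i = (\<Sum>k\<in>K. if k = i then 1 else 0)"
    unfolding mat_mul_def
  proof (intro sum.cong refl)
    fix k assume "k \<in> K"
    then show "A i k * B k i = (if k = i then 1 else 0)"
      using A B i by (cases k i rule: linorder_cases) (auto simp: unitriangular_def)
  qed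
  then show "mat_mul K A B i i = 1"
    using K i by (simp add: sum.delta)
next
  fix i j :: 'k assume ij: "j < i"
  show "mat_mul K A B i j = 0"
    unfolding mat_mul_def
  proof (intro sum.neutral ballI)
    fix k
    have "k < i \<or> j < k" using ij by auto
    then show "A i k * B k j = 0"
      using A B by (auto simp: unitriangular_def)
  qed
qed

text \<open>A matrix carried along with its inverse. Products of elementary matrices build both at
  once, which gives triangularity of the inverse without inverting a general triangular
  matrix.\<close>

definition unitriangular_inverses :: "'k::linorder set \<Rightarrow> ('k \<Rightarrow> 'k \<Rightarrow> 'f::field) \<Rightarrow> ('k \<Rightarrow> 'k \<Rightarrow> 'f) \<Rightarrow> bool" where
  "unitriangular_inverses K A B \<longleftrightarrow> unitriangular K A \<and> unitriangular K B \<and>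
     mat_mul K A B = id_mat K \<and> mat_mul K B A = id_mat K"

lemma unitriangular_inverses_id: "finite K \<Longrightarrow> unitriangular_inverses K (id_mat K) (id_mat K)"
  using unitriangular_id[of K]
  by (auto simp: unitriangular_inverses_def mat_mul_id_zero_outside unitriangular_def)

lemma elem_mul_elem:
  fixes a :: "'f::field" and k l :: "'k::linorder"
  assumes K: "finite K" and k: "k \<in> K" "l \<in> K" "k < l"
  shows "mat_mul K (elem_mat K k l a) (elem_mat K k l (- a)) = id_mat K"
proof (intro ext)
  fix i j
  have "zero_outside K (elem_mat K k l a)"
    using unitriangular_elem[OF k, of a] by (simp add: unitriangular_def)
  then show "mat_mul K (elem_mat K k l a) (elem_mat K k l (- a)) i j = id_mat K i j"
    using k by (simp add: mat_mul_elem[OF K k(1,2)] mat_mul_id_zero_outside K)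
      (auto simp: elem_mat_def id_mat_def)
qed

lemma unitriangular_inverses_elem:
  assumes "finite K" "k \<in> K" "l \<in> K" "k < l"
  shows "unitriangular_inverses K (elem_mat K k l a) (elem_mat K k l (- a))"
  using elem_mul_elem[OF assms, of a] elem_mul_elem[OF assms, of "- a"] assms
  by (simp add: unitriangular_inverses_def unitriangular_elem)

lemma unitriangular_inverses_mul:
  assumes K: "finite K" and 1: "unitriangular_inverses K A B" and 2: "unitriangular_inverses K A' B'"
  shows "unitriangular_inverses K (mat_mul K A A') (mat_mul K B' B)"
proof -
  have "mat_mul K (mat_mul K P P') (mat_mul K Q' Q) = id_mat K"
    if "unitriangular_inverses K P Q" "unitriangular_inverses K P' Q'" for P P' Q Q' :: "'a \<Rightarrow> 'a \<Rightarrow> 'b"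
  proof -
    have "mat_mul K (mat_mul K P P') (mat_mul K Q' Q) = mat_mul K P (mat_mul K (mat_mul K P' Q') Q)"
      by (simp add: mat_mul_assoc)
    also have "\<dots> = id_mat K"
      using that K by (simp add: unitriangular_inverses_def unitriangular_def mat_mul_id_zero_outside)
    finally show ?thesis .
  qed
  moreover have "unitriangular_inverses K B A" "unitriangular_inverses K B' A'"
    using 1 2 by (auto simp: unitriangular_inverses_def)
  ultimately show ?thesis
    using 1 2 K by (simp add: unitriangular_inverses_def unitriangular_mul)
qed

lemma mat_inv_eqI:
  assumes K: "finite K" and zB: "zero_outside K B"
    and AB: "mat_mul K A B = id_mat K" and BA: "mat_mul K B A = id_mat K"
  shows "mat_inv K A = B"
  unfolding mat_inv_def
proof (rule the_equality)
  show "(\<forall>i j. i \<notin> K \<or> j \<notin> K \<longrightarrow> B i j = 0) \<and>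
    (\<forall>i\<in>K. \<forall>j\<in>K. mat_mul K A B i j = id_mat K i j \<and> mat_mul K B A i j = id_mat K i j)"
    using assms by (simp add: zero_outside_def)
next
  fix C assume C: "(\<forall>i j. i \<notin> K \<or> j \<notin> K \<longrightarrow> C i j = 0) \<and>
    (\<forall>i\<in>K. \<forall>j\<in>K. mat_mul K A C i j = id_mat K i j \<and> mat_mul K C A i j = id_mat K i j)"
  have zC: "zero_outside K C"
    using C by (simp add: zero_outside_def)
  have "C = mat_mul K (mat_mul K B A) C"
    by (simp add: BA mat_mul_id_zero_outside K zC)
  also have "\<dots> = mat_mul K B (mat_mul K A C)"
    by (simp add: mat_mul_assoc)
  \<comment> \<open>\<open>A C\<close> is known to be the identity only on
    \<open>K \<times> K\<close>; for a column outside \<open>K\<close> both sides vanish.\<close>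
  also have "\<dots> = B"
  proof (intro ext)
    fix i j
    show "mat_mul K B (mat_mul K A C) i j = B i j"
    proof (cases "j \<in> K")
      case True
      then have "mat_mul K B (mat_mul K A C) i j = mat_mul K B (id_mat K) i j"
        using C by (simp add: mat_mul_def)
      then show ?thesis
        by (simp add: mat_mul_id_zero_outside K zB)
    next
      case False
      then have "mat_mul K A C i j = 0" for i
        using zC by (simp add: mat_mul_def zero_outside_def)
      then show ?thesis
        using False zB by (simp add: mat_mul_def[of K B] zero_outside_def)
    qed
  qed
  finally show "C = B" .
qed

lemma mat_inv_unitriangular: "finite K \<Longrightarrow> unitriangular_inverses K A B \<Longrightarrow> mat_inv K A = B"
  by (simp add: mat_inv_eqI unitriangular_inverses_def unitriangular_def)

lemma transpose_mul: "mat_transpose (mat_mul K A B) = mat_mul K (mat_transpose B) (mat_transpose A)"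
  by (intro ext) (simp add: mat_transpose_def mat_mul_def mult.commute)

lemma transpose_id: "mat_transpose (id_mat K) = id_mat K"
  by (intro ext) (auto simp: mat_transpose_def id_mat_def)

lemma transpose_transpose: "mat_transpose (mat_transpose A) = A"
  by (simp add: mat_transpose_def)

text \<open>Row reduction is column reduction of the transpose; this transfers the inverse of a
  column reducer to \<open>row_reducer\<close>.\<close>

lemma mat_inv_transpose:
  assumes "finite K" and "unitriangular_inverses K A B"
  shows "mat_inv K (mat_transpose A) = mat_transpose B"
proof (rule mat_inv_eqI[OF assms(1)])
  show "zero_outside K (mat_transpose B)"
    using assms by (auto simp: unitriangular_inverses_def unitriangular_def zero_outside_def mat_transpose_def)
qed (use assms in \<open>simp_all add: transpose_mul[symmetric] unitriangular_inverses_def transpose_id\<close>)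

section \<open>Leading entries and the invariant of the reduction\<close>

definition is_lead :: "'i::linorder set \<Rightarrow> ('i \<Rightarrow> 'f::zero) \<Rightarrow> 'i \<Rightarrow> bool" where
  "is_lead I x i \<longleftrightarrow> i \<in> I \<and> x i \<noteq> 0 \<and> (\<forall>i'\<in>I. i' < i \<longrightarrow> x i' = 0)"

lemma is_lead_unique: "is_lead I x i \<Longrightarrow> is_lead I x i' \<Longrightarrow> i = i'"
  by (metis is_lead_def linorder_neqE)

lemma is_lead_cong: "(\<And>i. i \<in> I \<Longrightarrow> x i = y i) \<Longrightarrow> is_lead I x l \<longleftrightarrow> is_lead I y l"
  by (auto simp: is_lead_def)

lemma is_lead_pivot_row:
  assumes "finite I" "\<exists>i\<in>I. Y i j \<noteq> 0"
  shows "is_lead I (\<lambda>i. Y i j) (pivot_row I Y j)"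
proof -
  let ?S = "{i \<in> I. Y i j \<noteq> 0}"
  have S: "finite ?S" "?S \<noteq> {}" using assms by auto
  then have "Min ?S \<in> ?S" by (rule Min_in)
  moreover have "Y i j = 0" if "i \<in> I" "i < Min ?S" for i
    using that S Min_le[of ?S i] by force
  ultimately show ?thesis
    by (auto simp: is_lead_def pivot_row_def)
qed

lemma is_lead_exists: "finite I \<Longrightarrow> i \<in> I \<Longrightarrow> x i \<noteq> 0 \<Longrightarrow> \<exists>l. is_lead I x l \<and> l \<le> i"
proof -
  assume *: "finite I" "i \<in> I" "x i \<noteq> 0"
  then have "is_lead I x (pivot_row I (\<lambda>i _. x i) ())"
    using is_lead_pivot_row[of I "\<lambda>i _. x i" "()"] by blast
  then show ?thesis
    using * by (metis is_lead_def not_le_imp_less)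
qed

text \<open>What the reduction is meant to achieve: distinct nonzero columns have distinct pivot
  rows. Zero columns have no lead and satisfy the condition vacuously.\<close>

definition reduced :: "'i::linorder set \<Rightarrow> 'j set \<Rightarrow> ('i \<Rightarrow> 'j \<Rightarrow> 'f::zero) \<Rightarrow> bool" where
  "reduced I J Y \<longleftrightarrow> (\<forall>j\<in>J. \<forall>j'\<in>J. \<forall>i. is_lead I (\<lambda>i. Y i j) i \<longrightarrow> is_lead I (\<lambda>i. Y i j') i \<longrightarrow> j = j')"

text \<open>Each \<open>clear_column\<close> consults the current matrix, but column
  \<open>j\<close> never changes and every other column changes only at its own turn, so all
  multipliers can be read off the initial \<open>mat_mul J X T\<close>.\<close>

lemma fold_clear_column:
  fixes I :: "'i::linorder set" and X :: "'i \<Rightarrow> 'j::linorder \<Rightarrow> 'f::field"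
  assumes J: "finite J" and j: "j \<in> J" and js: "distinct js" "set js \<subseteq> {j'\<in>J. j < j'}"
    and T: "\<exists>B. unitriangular_inverses J T B" and nz: "mat_mul J X T i j \<noteq> 0"
  shows "(\<exists>B. unitriangular_inverses J (fold (clear_column I J X i j) js T) B) \<and>
    (\<forall>r. \<forall>c\<in>J. mat_mul J X (fold (clear_column I J X i j) js T) r c =
    (if c \<in> set js then mat_mul J X T r c - mat_mul J X T i c / mat_mul J X T i j * mat_mul J X T r j
     else mat_mul J X T r c))"
  using js T nz
proof (induction js arbitrary: T)
  case Nil
  then show ?case by simp
next
  case (Cons l js)
  let ?Y = "mat_mul J X T"
  let ?E = "elem_mat J j l (- ?Y i l / ?Y i j)"
  let ?T = "clear_column I J X i j l T"
  have l: "l \<in> J" "j < l" using Cons.prems by auto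
  have T: "?T = mat_mul J T ?E"
    by (simp add: clear_column_def Let_def)
  have inv: "\<exists>B. unitriangular_inverses J ?T B"
    using Cons.prems unitriangular_inverses_mul[OF J _ unitriangular_inverses_elem[OF J j l]] unfolding T by blast
  have Y': "mat_mul J X ?T r c = ?Y r c + (if c = l then - ?Y i l / ?Y i j * ?Y r j else 0)"
    if "c \<in> J" for r c
  proof -
    have "mat_mul J X ?T r c = mat_mul J ?Y ?E r c"
      by (simp add: T mat_mul_assoc)
    then show ?thesis
      by (simp add: mat_mul_elem[OF J j l(1)] mat_mul_id_right J that)
  qed
  have nz: "mat_mul J X ?T i j \<noteq> 0"
    using Y'[OF j, of i] l Cons.prems by simp
  have "distinct js" "set js \<subseteq> {j'\<in>J. j < j'}" "l \<notin> set js"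
    using Cons.prems by auto
  from Cons.IH[OF this(1,2) inv nz] this(3) show ?case
    using Y' j l by (auto simp: algebra_simps)
qed

text \<open>\<open>D\<close> holds the columns already processed; the invariant is that the pivot
  row of a processed column vanishes in every greater column. The current column is one of these, so
  adding multiples of it to later columns preserves the zeros.\<close>

lemma fold_process_column:
  assumes J: "finite J" and I: "finite I" and js: "sorted js" "distinct js" "D \<union> set js = J"
    "\<And>k l. k \<in> D \<Longrightarrow> l \<in> set js \<Longrightarrow> k < l"
    and T: "\<exists>B. unitriangular_inverses J T B"
    and inv: "\<And>k l i. k \<in> D \<Longrightarrow> l \<in> J \<Longrightarrow> k < l \<Longrightarrow> is_lead I (\<lambda>i. mat_mul J X T i k) i \<Longrightarrow> mat_mul J X T i l = 0"
  defines "T' \<equiv> fold (process_column I J X) js T"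
  shows "(\<exists>B. unitriangular_inverses J T' B) \<and>
    (\<forall>k\<in>J. \<forall>l\<in>J. \<forall>i. k < l \<longrightarrow> is_lead I (\<lambda>i. mat_mul J X T' i k) i \<longrightarrow> mat_mul J X T' i l = 0)"
  using js T inv unfolding T'_def
proof (induction js arbitrary: D T)
  case Nil
  then show ?case by auto
next
  case (Cons j js)
  let ?Y = "mat_mul J X T"
  let ?T = "process_column I J X j T"
  let ?Y' = "mat_mul J X ?T"
  have j: "j \<in> J" using Cons.prems by auto
  \<comment> \<open>As the list is sorted and lies above \<open>D\<close>, the columns still to come
    are exactly those to which column \<open>j\<close> is added.\<close>
  have js: "l \<in> set js \<longleftrightarrow> l \<in> J \<and> j < l" for l
    using Cons.prems by (auto simp: order_less_le) (metis less_asym Cons.prems(4) UnE list.set_intros(1) order_less_le set_ConsD)+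
  have step: "(\<exists>B. unitriangular_inverses J ?T B) \<and>
    (\<forall>k\<in>insert j D. \<forall>l\<in>J. \<forall>i. k < l \<longrightarrow> is_lead I (\<lambda>i. ?Y' i k) i \<longrightarrow> ?Y' i l = 0)"
  proof (cases "\<forall>i\<in>I. ?Y i j = 0")
    case True
    then have "?T = T"
      by (simp add: process_column_def Let_def)
    then show ?thesis
      using Cons.prems True by (auto simp: is_lead_def)
  next
    case False
    define i where "i = pivot_row I ?Y j"
    have lead: "is_lead I (\<lambda>i. ?Y i j) i"
      unfolding i_def using False I by (intro is_lead_pivot_row) auto
    have T: "?T = fold (clear_column I J X i j) (sorted_list_of_set {j'\<in>J. j < j'}) T"
      by (simp only: process_column_def Let_def i_def if_not_P[OF False])
    have nz: "?Y i j \<noteq> 0"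
      using lead by (simp add: is_lead_def)
    have res: "\<exists>B. unitriangular_inverses J ?T B" "\<forall>r. \<forall>c\<in>J. ?Y' r c =
      (if j < c then ?Y r c - ?Y i c / ?Y i j * ?Y r j else ?Y r c)"
      using fold_clear_column[OF J j _ _ Cons.prems(5) nz, of "sorted_list_of_set {j'\<in>J. j < j'}" I] J
      by (auto simp: T)
    show ?thesis
    proof (intro conjI ballI allI impI)
      show "\<exists>B. unitriangular_inverses J ?T B" by (rule res)
    next
      fix k l r assume k: "k \<in> insert j D" and l: "l \<in> J" "k < l" and r: "is_lead I (\<lambda>i. ?Y' i k) r"
      have kJ: "k \<in> J" "k \<le> j"
        using k Cons.prems(3,4) j by (auto simp: order_less_le)
      \<comment> \<open>Columns up to \<open>j\<close> are untouched, so their leads are those from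
        before this step.\<close>
      have "(\<lambda>i. ?Y' i k) = (\<lambda>i. ?Y i k)"
        using res kJ by (auto simp: not_less[symmetric])
      with r have r: "is_lead I (\<lambda>i. ?Y i k) r" by simp
      show "?Y' r l = 0"
      proof (cases "k = j")
        case True
        then have "r = i" using r lead is_lead_unique by blast
        then show ?thesis using res l True nz by simp
      next
        case False
        then have kD: "k \<in> D" "k < j" using k kJ by auto
        then have "?Y r j = 0" "?Y r l = 0"
          using Cons.prems(6)[OF kD(1)] r j l by auto
        then show ?thesis using res l by simp
      qed
    qed
  qed
  show ?case
    unfolding fold_Cons comp_apply
  proof (rule Cons.IH[of "insert j D"])
    show "sorted js" "distinct js" "insert j D \<union> set js = J"
      using Cons.prems(1-3) by auto
    show "k < l" if "k \<in> insert j D" "l \<in> set js" for k l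
      using that js Cons.prems(4)[of k l] by auto
    show "\<exists>B. unitriangular_inverses J ?T B"
      using step by blast
    show "?Y' i l = 0" if "k \<in> insert j D" "l \<in> J" "k < l" "is_lead I (\<lambda>i. ?Y' i k) i" for k l i
      using step that by blast
  qed
qed

lemma column_reducer_props:
  assumes J: "finite J" and I: "finite I"
  shows "\<exists>B. unitriangular_inverses J (column_reducer I J X) B"
    and "reduced I J (mat_mul J X (column_reducer I J X))"
proof -
  have *: "(\<exists>B. unitriangular_inverses J (column_reducer I J X) B) \<and>
    (\<forall>k\<in>J. \<forall>l\<in>J. \<forall>i. k < l \<longrightarrow> is_lead I (\<lambda>i. mat_mul J X (column_reducer I J X) i k) i \<longrightarrow>
       mat_mul J X (column_reducer I J X) i l = 0)"
    unfolding column_reducer_def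
    by (rule fold_process_column[OF J I, where D = "{}"]) (use J unitriangular_inverses_id in auto)
  then show "\<exists>B. unitriangular_inverses J (column_reducer I J X) B" by blast
  let ?W = "mat_mul J X (column_reducer I J X)"
  have "\<not> k < l" if "k \<in> J" "l \<in> J" "is_lead I (\<lambda>i. ?W i k) i" "is_lead I (\<lambda>i. ?W i l) i" for k l i
  proof
    assume "k < l"
    then have "?W i l = 0" using * that by blast
    then show False using that by (simp add: is_lead_def)
  qed
  then show "reduced I J ?W"
    unfolding reduced_def by (meson linorder_neqE)
qed

section \<open>Pivots as leading entries of columns and of rows\<close>

lemma pivots_iff:
  assumes "finite I"
  shows "(i, j) \<in> pivots I J X \<longleftrightarrow> j \<in> J \<and> is_lead I (\<lambda>i. mat_mul J X (column_reducer I J X) i j) i"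
proof -
  let ?Y = "mat_mul J X (column_reducer I J X)"
  have "(i = pivot_row I ?Y j \<and> (\<exists>i\<in>I. ?Y i j \<noteq> 0)) \<longleftrightarrow> is_lead I (\<lambda>i. ?Y i j) i"
  proof
    assume lead: "is_lead I (\<lambda>i. ?Y i j) i"
    then have nz: "\<exists>i\<in>I. ?Y i j \<noteq> 0"
      by (auto simp: is_lead_def)
    then show "i = pivot_row I ?Y j \<and> (\<exists>i\<in>I. ?Y i j \<noteq> 0)"
      using is_lead_unique[OF lead is_lead_pivot_row[where Y = ?Y, OF assms nz]] by simp
  qed (use is_lead_pivot_row[OF assms, of ?Y j] in blast)
  then show ?thesis
    by (auto simp: pivots_def Let_def)
qed

text \<open>Under an upper unitriangular matrix, entry \<open>k\<close> of the product collects only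
  entries of \<open>x\<close> at positions at most \<open>k\<close>: nothing before
  \<open>l\<close>, and exactly \<open>x l\<close> at \<open>l\<close>.\<close>

lemma unitriangular_mul_lead:
  fixes A :: "'k::linorder \<Rightarrow> 'k \<Rightarrow> 'f::field"
  assumes K: "finite K" and A: "unitriangular K A" and x: "is_lead K x l"
  shows "is_lead K (\<lambda>k. \<Sum>m\<in>K. x m * A m k) l"
proof -
  have z: "x m * A m k = 0" if "m \<in> K" "k \<le> l" "m \<noteq> l \<or> k \<noteq> l" for m k
  proof -
    have "m < l \<or> k < m" using that by (cases m l rule: linorder_cases) auto
    then show ?thesis using x A that by (auto simp: is_lead_def unitriangular_def)
  qed
  have l: "l \<in> K" "A l l = 1"
    using x A by (auto simp: is_lead_def unitriangular_def)
  have "(\<Sum>m\<in>K. x m * A m l) = x l * A l l"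
    using K l z by (subst sum.remove[of _ l]) (auto intro!: sum.neutral simp del: mult_eq_0_iff)
  moreover have "(\<Sum>m\<in>K. x m * A m k) = 0" if "k < l" for k
    using that by (intro sum.neutral ballI z) auto
  ultimately show ?thesis
    using x l by (simp add: is_lead_def)
qed

text \<open>The new direction applies the preceding fact to the inverse, since (x A) B = x.\<close>

lemma unitriangular_mul_lead_iff:
  fixes A :: "'k::linorder \<Rightarrow> 'k \<Rightarrow> 'f::field"
  assumes K: "finite K" and A: "unitriangular_inverses K A B"
  shows "is_lead K (\<lambda>k. \<Sum>m\<in>K. x m * A m k) l \<longleftrightarrow> is_lead K x l"
proof
  assume "is_lead K (\<lambda>k. \<Sum>m\<in>K. x m * A m k) l"
  then have "is_lead K (\<lambda>k. \<Sum>m\<in>K. (\<Sum>n\<in>K. x n * A n m) * B m k) l"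
    using A by (intro unitriangular_mul_lead[OF K, of B]) (simp_all add: unitriangular_inverses_def)
  moreover have "(\<Sum>m\<in>K. (\<Sum>n\<in>K. x n * A n m) * B m k) = x k" if "k \<in> K" for k
  proof -
    \<comment> \<open>The vector is viewed as a matrix with all rows equal to \<open>x\<close>, so
      that associativity of \<open>mat_mul\<close> applies.\<close>
    have "(\<Sum>m\<in>K. (\<Sum>n\<in>K. x n * A n m) * B m k) = mat_mul K (mat_mul K (\<lambda>_. x) A) B k k"
      by (simp add: mat_mul_def)
    also have "\<dots> = x k"
      using A K that by (simp add: mat_mul_assoc unitriangular_inverses_def mat_mul_id_right)
    finally show ?thesis .
  qed
  ultimately show "is_lead K x l"
    by (simp cong: is_lead_cong)
next
  assume "is_lead K x l"
  then show "is_lead K (\<lambda>k. \<Sum>m\<in>K. x m * A m k) l"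
    using A by (intro unitriangular_mul_lead[OF K, of A]) (simp_all add: unitriangular_inverses_def)
qed

text \<open>Strong induction on the number of rows above \<open>i\<close>. If row \<open>i\<close>
  led at some \<open>l < j\<close>, column \<open>l\<close> would lead at a row
  \<open>k < i\<close>, because columns \<open>l\<close> and \<open>j\<close> cannot share the lead
  \<open>i\<close>. By induction row \<open>k\<close> would lead at \<open>l\<close>, as row
  \<open>i\<close> does, but rows do not share leads either.\<close>

lemma column_leads_are_row_leads:
  fixes Y :: "'i::linorder \<Rightarrow> 'j::linorder \<Rightarrow> 'f::zero"
  assumes I: "finite I" and J: "finite J"
    and c: "reduced I J Y" and r: "reduced J I (mat_transpose Y)"
    and j: "j \<in> J" and i: "is_lead I (\<lambda>i. Y i j) i"
  shows "is_lead J (Y i) j"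
  using j i
proof (induction "card {i'\<in>I. i' < i}" arbitrary: i j rule: less_induct)
  case less
  have iI: "i \<in> I" "Y i j \<noteq> 0" using less.prems by (auto simp: is_lead_def)
  obtain l where l: "is_lead J (Y i) l" "l \<le> j"
    using is_lead_exists[OF J less.prems(1), of "Y i"] iI by blast
  have lJ: "l \<in> J" "Y i l \<noteq> 0" using l by (auto simp: is_lead_def)
  show ?case
  proof (cases "l = j")
    case False
    obtain k where k: "is_lead I (\<lambda>i. Y i l) k" "k \<le> i"
      using is_lead_exists[OF I iI(1), of "\<lambda>i. Y i l"] lJ by blast
    have kI: "k \<in> I" using k by (simp add: is_lead_def)
    have "k \<noteq> i"
      using c False lJ less.prems k by (auto simp: reduced_def)
    then have "k < i" using k by simp
    then have "card {i'\<in>I. i' < k} < card {i'\<in>I. i' < i}"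
      using I kI by (intro psubset_card_mono) auto
    from less.hyps[OF this lJ(1) k(1)] have "is_lead J (Y k) l" .
    then have "k = i"
      using r l kI iI by (auto simp: reduced_def mat_transpose_def)
    with \<open>k \<noteq> i\<close> show ?thesis by simp
  qed (use l in simp)
qed

lemma row_pivots_eq_column_pivots:
  fixes X :: "'i::linorder \<Rightarrow> 'j::linorder \<Rightarrow> 'f::field"
  assumes I: "finite I" and J: "finite J" and i: "i \<in> I" and j: "j \<in> J"
  shows "is_lead J (mat_mul I (row_reducer I J X) X i) j
    \<longleftrightarrow> is_lead I (\<lambda>i. mat_mul J X (column_reducer I J X) i j) i"
proof -
  define T where "T = column_reducer I J X"
  define R where "R = column_reducer J I (mat_transpose X)"
  define S where "S = row_reducer I J X"
  have S: "S = mat_transpose R" by (simp add: S_def R_def row_reducer_def)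
  obtain T' where T': "unitriangular_inverses J T T'"
    using column_reducer_props(1)[OF J I] T_def by blast
  obtain R' where R': "unitriangular_inverses I R R'"
    using column_reducer_props(1)[OF I J] R_def by blast
  define Y where "Y = mat_mul J (mat_mul I S X) T"
  have Y2: "Y = mat_mul I S (mat_mul J X T)"
    by (simp add: Y_def mat_mul_assoc)
  \<comment> \<open>\<open>T\<close> acts on rows from the right and \<open>S\<close> on columns
    from the left. As \<open>S\<close> is the transpose of an upper unitriangular matrix, both
    actions preserve leads.\<close>
  have row: "is_lead J (Y i) j \<longleftrightarrow> is_lead J (mat_mul I S X i) j" for i j
    using unitriangular_mul_lead_iff[OF J T', of "mat_mul I S X i" j]
    by (simp add: Y_def mat_mul_def[of J])
  have col: "is_lead I (\<lambda>i. Y i j) i \<longleftrightarrow> is_lead I (\<lambda>i. mat_mul J X T i j) i" for i j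
    using unitriangular_mul_lead_iff[OF I R', of "\<lambda>i. mat_mul J X T i j" i]
    by (simp add: Y2 S mat_mul_def[of I] mat_transpose_def mult.commute)
  have rY: "reduced I J Y"
    using column_reducer_props(2)[OF J I, of X] by (simp add: reduced_def col T_def)
  have "mat_mul I S X = mat_transpose (mat_mul I (mat_transpose X) R)"
    by (simp add: S transpose_mul transpose_transpose)
  then have "reduced J I (mat_transpose (mat_mul I S X))"
    using column_reducer_props(2)[OF I J, of "mat_transpose X"] by (simp add: R_def transpose_transpose)
  then have rY': "reduced J I (mat_transpose Y)"
    by (simp add: reduced_def mat_transpose_def row)
  \<comment> \<open>The converse is the same fact for the transpose of \<open>Y\<close>.\<close>
  have "is_lead J (Y i) j \<longleftrightarrow> is_lead I (\<lambda>i. Y i j) i"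
    using column_leads_are_row_leads[OF I J rY rY' j]
      column_leads_are_row_leads[OF J I rY' _ i, of j] rY
    by (auto simp: transpose_transpose) (auto simp: mat_transpose_def)
  then show ?thesis
    by (simp add: row col S_def T_def)
qed

subsection \<open>Echelon factorizations\<close>

text \<open>Among the rows with nonzero coefficient, the one with the smallest lead cannot be
  cancelled there, since all others lead strictly later. The bound
  \<open>q k\<^sub>0 \<le> q k\<close> later carries an inequality from the surviving entry to
  \<open>k\<close>.\<close>

lemma echelon_combination_lead:
  fixes M :: "'k \<Rightarrow> 'j::linorder \<Rightarrow> 'f::field"
  assumes K: "finite K" and lead: "\<And>k. k \<in> K \<Longrightarrow> is_lead J (M k) (q k)" and inj: "inj_on q K"
    and k: "k \<in> K" "c k \<noteq> 0"
  shows "\<exists>k\<^sub>0\<in>K. c k\<^sub>0 \<noteq> 0 \<and> q k\<^sub>0 \<le> q k \<and> (\<Sum>k\<in>K. c k * M k (q k\<^sub>0)) \<noteq> 0"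
proof -
  let ?S = "{k\<in>K. c k \<noteq> 0}"
  have S: "finite (q ` ?S)" "q ` ?S \<noteq> {}" using K k by auto
  then have "Min (q ` ?S) \<in> q ` ?S" by (rule Min_in)
  then obtain m where m: "m \<in> K" "c m \<noteq> 0" "q m = Min (q ` ?S)" by auto
  have le: "q m \<le> q l" if "l \<in> K" "c l \<noteq> 0" for l
    unfolding m(3) by (rule Min_le[OF S(1)]) (use that in blast)
  have "c l * M l (q m) = 0" if "l \<in> K - {m}" for l
  proof (cases "c l = 0")
    case False
    then have "q m < q l"
      using le[of l] that inj m by (auto simp: order_less_le inj_on_def)
    then show ?thesis
      using lead[of l] lead[OF m(1)] that by (auto simp: is_lead_def)
  qed simp
  then have "(\<Sum>k\<in>K. c k * M k (q m)) = c m * M m (q m)"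
    using K m by (subst sum.remove[of _ m]) (auto intro: sum.neutral simp del: mult_eq_0_iff)
  then show ?thesis
    using m le k lead[OF m(1)] by (auto simp: is_lead_def)
qed

text \<open>Back substitution: the row \<open>m\<close> with the greatest lead vanishes at all other
  pivots, so it alone fixes the unknown at \<open>q m\<close>; the right-hand sides of the other
  rows are corrected accordingly. The solution is kept on pivot columns because these can be shown
  to be alive.\<close>

lemma echelon_solvable:
  fixes M :: "'k \<Rightarrow> 'j::linorder \<Rightarrow> 'f::field"
  assumes "finite K" and J: "finite J" and "\<And>k. k \<in> K \<Longrightarrow> is_lead J (M k) (q k)" and "inj_on q K"
  shows "\<exists>x\<in>supported (q ` K). \<forall>k\<in>K. (\<Sum>j\<in>J. M k j * x j) = y k"
  using assms(1,3,4)
proof (induction K arbitrary: y rule: finite_ranking_induct[where f = q])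
  case empty
  then show ?case by (intro bexI[of _ 0]) (auto simp: supported_def)
next
  case (insert m K)
  show ?case
  proof (cases "m \<in> K")
    case True
    then show ?thesis using insert by (simp add: insert_absorb)
  next
    case False
    define a where "a = y m / M m (q m)"
    have m: "q m \<in> J" "M m (q m) \<noteq> 0"
      using insert.prems(1)[of m] by (auto simp: is_lead_def)
    obtain x where x: "x \<in> supported (q ` K)" "\<forall>k\<in>K. (\<Sum>j\<in>J. M k j * x j) = y k - M k (q m) * a"
      using insert.IH[of "\<lambda>k. y k - M k (q m) * a"] insert.prems by (auto simp: inj_on_insert)
    let ?x = "x(q m := a)"
    have notin: "q m \<notin> q ` K"
      using insert.prems(2) False by (auto simp: inj_on_insert)
    then have x0: "x (q m) = 0"
      using x by (simp add: supported_def)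
    have sum: "(\<Sum>j\<in>J. M k j * ?x j) = (\<Sum>j\<in>J. M k j * x j) + M k (q m) * a" for k
    proof -
      have "(\<Sum>j\<in>J. M k j * ?x j) = (\<Sum>j\<in>J. M k j * x j + (if j = q m then M k (q m) * a else 0))"
        using x0 by (intro sum.cong) auto
      then show ?thesis
        using J m by (simp add: sum.distrib)
    qed
    have "M m j * x j = 0" if "j \<in> J" for j
    proof (cases "x j = 0")
      case False
      then have j: "j \<in> q ` K" using x by (auto simp: supported_def)
      then have "j \<noteq> q m" using notin by blast
      moreover have "j \<le> q m" using j insert.hyps(2) by blast
      ultimately have "j < q m" by simp
      then show ?thesis using insert.prems(1)[of m] that by (simp add: is_lead_def)
    qed simp
    then have "(\<Sum>j\<in>J. M m j * x j) = 0" by (rule sum.neutral[rule_format])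
    then have "\<forall>k\<in>insert m K. (\<Sum>j\<in>J. M k j * ?x j) = y k"
      using x m False unfolding sum by (auto simp: a_def)
    moreover have "?x \<in> supported (q ` insert m K)"
      using x by (auto simp: supported_def)
    ultimately show ?thesis by blast
  qed
qed

text \<open>\<open>q k\<close> and \<open>q' k\<close> are the row and the column of pivot
  \<open>k\<close>. Births \<open>e\<close> and deaths \<open>f\<close> are prescribed only on
  \<open>N\<close>, since their descriptions through \<open>p\<close> and \<open>p'\<close> make
  sense only at nontrivial pivots.\<close>

lemma echelon_image_decomposition:
  fixes U :: "('r::linorder, 'f::field, 'u::ab_group_add) pmod"
    and V :: "('r, 'f, 'v::ab_group_add) pmod"
    and J :: "'j::linorder set" and I :: "'i::linorder set" and K :: "'k set"
  assumes U: "interval_decomposition U J b' d' \<alpha>"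
    and V: "interval_decomposition V I b d \<beta>"
    and orders: "standard_orders J b' I d"
    and X: "represents U J b' d' \<alpha> V I b d \<beta> X \<phi>"
    and K: "finite K" and inj: "inj_on q K" "inj_on q' K"
    and L: "\<And>k. k \<in> K \<Longrightarrow> is_lead I (\<lambda>i. L i k) (q k)"
    and M: "\<And>k. k \<in> K \<Longrightarrow> is_lead J (M k) (q' k)"
    and XLM: "\<And>i j. i \<in> I \<Longrightarrow> j \<in> J \<Longrightarrow> X i j = (\<Sum>k\<in>K. L i k * M k j)"
    and N: "N = {k\<in>K. b' (q' k) < d (q k)}"
    and e: "\<And>k. k \<in> N \<Longrightarrow> e k = b' (q' k)" and f: "\<And>k. k \<in> N \<Longrightarrow> f k = d (q k)"
  shows "\<exists>\<gamma>. interval_decomposition (pmod_image U V \<phi>) N e f \<gamma>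
     \<and> represents U J b' d' \<alpha> (pmod_image U V \<phi>) N e f \<gamma> M \<phi>
     \<and> represents (pmod_image U V \<phi>) N e f \<gamma> V I b d \<beta> L (\<lambda>t v. v)"
proof -
  have J: "finite J" and I: "finite I"
    using U V by (simp_all add: interval_decomposition_def)
  have X0: "b i \<le> b' j \<and> d i \<le> d' j" if "i \<in> I" "j \<in> J" "X i j \<noteq> 0" for i j
    using X that by (auto simp: represents_def not_less[symmetric])
  have b'_mono: "b' j \<le> b' l" if "j \<in> J" "l \<in> J" "j \<le> l" for j l
    using orders that by (metis leD leI standard_orders_def)
  have d_mono: "d i \<le> d l" if "i \<in> I" "l \<in> I" "l \<le> i" for i l
    using orders that by (metis leD leI standard_orders_def)
  have q: "q k \<in> I" "q' k \<in> J" "L (q k) k \<noteq> 0" "M k (q' k) \<noteq> 0" if "k \<in> K" for k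
    using L[OF that] M[OF that] by (auto simp: is_lead_def)
  \<comment> \<open>The death bound comes from the order, as column \<open>k\<close> of
    \<open>L\<close> starts at row \<open>q k\<close>. For the birth, row \<open>i\<close> of
    \<open>X\<close> is a combination of the rows of \<open>M\<close> with coefficients
    \<open>L i\<close>; a surviving entry lies in a column \<open>q' m\<close> born no later than
    \<open>q' k\<close>.\<close>
  have L_nz: "b i \<le> b' (q' k) \<and> d i \<le> d (q k)" if i: "i \<in> I" and k: "k \<in> K" "L i k \<noteq> 0" for i k
  proof -
    have "q k \<le> i"
      using L[OF k(1)] i k by (auto simp: is_lead_def not_less[symmetric])
    obtain m where m: "m \<in> K" "q' m \<le> q' k" "(\<Sum>k\<in>K. L i k * M k (q' m)) \<noteq> 0"
      using echelon_combination_lead[OF K M inj(2) k(1), of "L i"] k by blast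
    then have "X i (q' m) \<noteq> 0"
      using XLM i q(2) by simp
    then have "b i \<le> b' (q' m)"
      using X0 i m q(2) by blast
    then show ?thesis
      using m k i q b'_mono[of "q' m" "q' k"] d_mono[of i "q k"] \<open>q k \<le> i\<close> by auto
  qed
  \<comment> \<open>Roles exchanged: the order gives the birth bound, and a surviving entry of
    column \<open>j\<close> of \<open>X\<close> in a row \<open>q m \<le> q k\<close> gives the
    death bound.\<close>
  have M_nz: "b' (q' k) \<le> b' j \<and> d (q k) \<le> d' j" if j: "j \<in> J" and k: "k \<in> K" "M k j \<noteq> 0" for j k
  proof -
    have "q' k \<le> j"
      using M[OF k(1)] j k by (auto simp: is_lead_def not_less[symmetric])
    obtain m where m: "m \<in> K" "q m \<le> q k" "(\<Sum>k\<in>K. M k j * L (q m) k) \<noteq> 0"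
      using echelon_combination_lead[where M = "\<lambda>k i. L i k" and c = "\<lambda>k. M k j", OF K L inj(1) k] by blast
    then have "X (q m) j \<noteq> 0"
      using XLM j q(1) by (simp add: mult.commute)
    then have "d (q m) \<le> d' j"
      using X0 j m q(1) by blast
    then show ?thesis
      using m k j q d_mono[of "q k" "q m"] b'_mono[of "q' k" j] \<open>q' k \<le> j\<close> by auto
  qed
  have NK: "N \<subseteq> K"
    unfolding N by blast
  have aliveN: "alive N e f t \<subseteq> K" for t
    by (rule order_trans[OF alive_subset NK])
  have alive_up: "t \<in> up (b' (q' k))" and alive_down: "t \<in> down (d (q k))" if "k \<in> alive N e f t" for k t
    using aliveD[OF that] e[of k] f[of k] by simp_all
  show ?thesis
  proof (rule image_decomposition[OF U V X])
    show "finite N" using K NK finite_subset by blast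
    show "e k \<le> f k" if "k \<in> N" for k
      using that e[OF that] f[OF that] by (simp add: N less_imp_le)
    show "e k \<le> b' j \<and> f k \<le> d' j" if "k \<in> N" "j \<in> J" "M k j \<noteq> 0" for k j
      using that M_nz[of j k] e[of k] f[of k] subsetD[OF NK, of k] by simp
    show "b i \<le> e k \<and> d i \<le> f k" if "i \<in> I" "k \<in> N" "L i k \<noteq> 0" for i k
      using that L_nz[of i k] e[of k] f[of k] subsetD[OF NK, of k] by simp
    \<comment> \<open>Trivial pivots and bars not alive at \<open>t\<close> contribute nothing: a
      nonzero product places \<open>t\<close> in the interval of \<open>k\<close>, which is then
      nonempty, so \<open>k\<close> is nontrivial.\<close>
    show "X i j = (\<Sum>k\<in>alive N e f t. L i k * M k j)"
      if i: "i \<in> alive I b d t" and j: "j \<in> alive J b' d' t" for t i j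
    proof -
      have iI: "i \<in> I" "t \<in> down (d i)" and jJ: "j \<in> J" "t \<in> up (b' j)"
        using aliveD i j by metis+
      have "k \<in> alive N e f t" if k: "k \<in> K" "L i k * M k j \<noteq> 0" for k
      proof -
        have "t \<in> down (d (q k))"
          using L_nz[of i k] down_mono[of "d i" "d (q k)"] iI k by auto
        moreover have "t \<in> up (b' (q' k))"
          using M_nz[of j k] up_antimono[of "b' (q' k)" "b' j"] jJ k by auto
        ultimately have *: "t \<in> bar (b' (q' k)) (d (q k))"
          by (simp add: bar_def)
        then have "k \<in> N"
          using bar_nonempty[OF *] k by (simp add: N)
        with * show ?thesis
          using e[of k] f[of k] by (simp add: alive_def)
      qed
      then show ?thesis
        unfolding XLM[OF iI(1) jJ(1)]
        using K aliveN by (intro sum.mono_neutral_right) auto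
    qed
    show "\<exists>x\<in>supported (alive J b' d' t). \<forall>k\<in>alive N e f t. (\<Sum>j\<in>alive J b' d' t. M k j * x j) = y k"
      for t y
    proof -
      have "\<exists>x\<in>supported (q' ` alive N e f t). \<forall>k\<in>alive N e f t. (\<Sum>j\<in>J. M k j * x j) = y k"
        using M subsetD[OF aliveN]
        by (intro echelon_solvable[OF finite_subset[OF aliveN K] J _ inj_on_subset[OF inj(2) aliveN]]) blast
      then obtain x where x: "x \<in> supported (q' ` alive N e f t)"
        "\<forall>k\<in>alive N e f t. (\<Sum>j\<in>J. M k j * x j) = y k" by blast
      \<comment> \<open>\<open>M k (q' k) \<noteq> 0\<close> gives
        \<open>d (q k) \<le> d' (q' k)\<close>, so the pivot column of a live bar is alive and the
        solution uses live columns only.\<close>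
      have "q' k \<in> alive J b' d' t" if k: "k \<in> alive N e f t" for k
      proof -
        have "k \<in> K" using k aliveN by blast
        then have "d (q k) \<le> d' (q' k)" using M_nz q by blast
        then show ?thesis
          using alive_up[OF k] alive_down[OF k] down_mono q \<open>k \<in> K\<close> by (blast intro: aliveI)
      qed
      then have "q' ` alive N e f t \<subseteq> alive J b' d' t"
        by blast
      then have xs: "x \<in> supported (alive J b' d' t)"
        using x(1) unfolding supported_def by blast
      have "(\<Sum>j\<in>alive J b' d' t. M k j * x j) = (\<Sum>j\<in>J. M k j * x j)" for k
        using J xs alive_subset[of J b' d' t] by (intro sum.mono_neutral_left) (auto simp: supported_def)
      then show ?thesis
        using x(2) xs by (intro bexI[of _ x]) simp_all
    qed
    show "\<forall>k\<in>alive N e f t. x k = 0"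
      if 0: "\<forall>i\<in>alive I b d t. (\<Sum>k\<in>alive N e f t. L i k * x k) = 0" for t x
    \<comment> \<open>A nonzero \<open>x\<close> leaves a nonzero entry of \<open>L x\<close> in
      some row \<open>q m\<close>; this row is alive because \<open>L (q m) m \<noteq> 0\<close>
      gives \<open>b (q m) \<le> b' (q' m)\<close>.\<close>
    proof (rule ccontr)
      assume "\<not> ?thesis"
      then obtain k where k: "k \<in> alive N e f t" "x k \<noteq> 0" by blast
      have L': "is_lead I (\<lambda>i. L i k) (q k)" if "k \<in> alive N e f t" for k
        using L that aliveN by blast
      obtain m where m: "m \<in> alive N e f t" "(\<Sum>k\<in>alive N e f t. x k * L (q m) k) \<noteq> 0"
        using echelon_combination_lead[where M = "\<lambda>k i. L i k" and c = x,
            OF finite_subset[OF aliveN K] L' inj_on_subset[OF inj(1) aliveN] k] by blast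
      have "m \<in> K" using m aliveN by blast
      then have "b (q m) \<le> b' (q' m)" using L_nz q by blast
      then have "q m \<in> alive I b d t"
        using alive_up[OF m(1)] alive_down[OF m(1)] up_antimono q \<open>m \<in> K\<close> by (blast intro: aliveI)
      with 0 m(2) show False
        by (simp add: mult.commute)
    qed
  qed
qed

section \<open>Row and column factorizations at the pivots\<close>

theorem theorem9p2:
  fixes U :: "('r::linorder, 'f::field, 'u::ab_group_add) pmod"
    and V :: "('r, 'f, 'v::ab_group_add) pmod"
    and \<phi> :: "'r \<Rightarrow> 'u \<Rightarrow> 'v"
    and J :: "'j::linorder set" and I :: "'i::linorder set"
    and b' d' :: "'j \<Rightarrow> 'r cut" and b d :: "'i \<Rightarrow> 'r cut"
    and \<alpha> :: "'r \<Rightarrow> 'u \<Rightarrow> 'j \<Rightarrow> 'f" and \<beta> :: "'r \<Rightarrow> 'v \<Rightarrow> 'i \<Rightarrow> 'f"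
    and X :: "'i \<Rightarrow> 'j \<Rightarrow> 'f"
    and N :: "('i \<times> 'j) set" and P\<^sub>I :: "'i set" and P\<^sub>J :: "'j set"
    and p :: "'j \<Rightarrow> 'i" and p' :: "'i \<Rightarrow> 'j"
    and S :: "'i \<Rightarrow> 'i \<Rightarrow> 'f" and T :: "'j \<Rightarrow> 'j \<Rightarrow> 'f"
    and im :: "('r, 'f, 'v) pmod"
  assumes U: "interval_decomposition U J b' d' \<alpha>"
    and V: "interval_decomposition V I b d \<beta>"
    and orders: "standard_orders J b' I d"
    and X: "represents U J b' d' \<alpha> V I b d \<beta> X \<phi>"
  defines "N \<equiv> nontrivial_pivots I d J b' X"
    and "P\<^sub>I \<equiv> fst ` N" and "P\<^sub>J \<equiv> snd ` N"
    and "p \<equiv> (\<lambda>j. THE i. (i, j) \<in> N)" and "p' \<equiv> (\<lambda>i. THE j. (i, j) \<in> N)"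
    and "S \<equiv> row_reducer I J X" and "T \<equiv> column_reducer I J X"
    and "im \<equiv> pmod_image U V \<phi>"
  shows "has_barcode im N (\<lambda>(i, j). b' j) (\<lambda>(i, j). d i)
    \<and> (\<exists>\<gamma>. interval_decomposition im P\<^sub>I (\<lambda>i. b' (p' i)) d \<gamma>
         \<and> represents U J b' d' \<alpha> im P\<^sub>I (\<lambda>i. b' (p' i)) d \<gamma> (mat_mul I S X) \<phi>
         \<and> represents im P\<^sub>I (\<lambda>i. b' (p' i)) d \<gamma> V I b d \<beta> (mat_inv I S) (\<lambda>t v. v))
    \<and> (\<exists>\<gamma>. interval_decomposition im P\<^sub>J b' (\<lambda>j. d (p j)) \<gamma>
         \<and> represents U J b' d' \<alpha> im P\<^sub>J b' (\<lambda>j. d (p j)) \<gamma> (mat_inv J T) \<phi>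
         \<and> represents im P\<^sub>J b' (\<lambda>j. d (p j)) \<gamma> V I b d \<beta> (mat_mul J X T) (\<lambda>t v. v))"
proof -
  have J: "finite J" and I: "finite I"
    using U V by (simp_all add: interval_decomposition_def)
  define P where "P = pivots I J X"
  define Z where "Z = mat_mul I S X"
  define W where "W = mat_mul J X T"
  have NP: "(i, j) \<in> N \<longleftrightarrow> (i, j) \<in> P \<and> b' j < d i" for i j
    by (simp add: N_def P_def nontrivial_pivots_def)
  have PW: "(i, j) \<in> P \<longleftrightarrow> j \<in> J \<and> is_lead I (\<lambda>i. W i j) i" for i j
    by (simp add: P_def W_def T_def pivots_iff[OF I])
  \<comment> \<open>Pivots are defined through column reduction; this reads the same positions off
    \<open>S X\<close>.\<close>
  have PZ: "(i, j) \<in> P \<longleftrightarrow> i \<in> I \<and> is_lead J (Z i) j" for i j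
  proof (cases "i \<in> I \<and> j \<in> J")
    case True
    then show ?thesis
      using row_pivots_eq_column_pivots[OF I J, of i j X]
      by (simp add: PW) (simp add: Z_def W_def S_def T_def)
  next
    case False
    then show ?thesis
      by (auto simp: PW is_lead_def)
  qed
  have uniq_col: "j = j'" if "(i, j) \<in> P" "(i, j') \<in> P" for i j j'
    using that is_lead_unique[of J "Z i"] by (auto simp: PZ)
  have uniq_row: "i = i'" if "(i, j) \<in> P" "(i', j) \<in> P" for i i' j
    using that is_lead_unique[of I "\<lambda>i. W i j"] by (auto simp: PW)
  have PIJ: "P \<subseteq> I \<times> J"
    using PW PZ by auto
  have finP: "finite P"
    using finite_subset[OF PIJ] I J by blast
  have inj: "inj_on fst P" "inj_on snd P"
    using uniq_col uniq_row by (auto simp: inj_on_def)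
  \<comment> \<open>A reduced column without pivot is zero, so its term drops out of the product of
    \<open>W\<close> with the inverse of \<open>T\<close>.\<close>
  have W0: "W i j = 0" if ij: "i \<in> I" "j \<in> J" "j \<notin> snd ` P" for i j
  proof (rule ccontr)
    assume "W i j \<noteq> 0"
    then obtain l where "is_lead I (\<lambda>i. W i j) l"
      using is_lead_exists[OF I ij(1), of "\<lambda>i. W i j"] by blast
    then have "(l, j) \<in> P"
      using ij by (simp add: PW)
    then show False
      using ij by force
  qed
  have Z0: "Z i j = 0" if ij: "i \<in> I" "j \<in> J" "i \<notin> fst ` P" for i j
  proof (rule ccontr)
    assume "Z i j \<noteq> 0"
    then obtain l where "is_lead J (Z i) l"
      using is_lead_exists[OF J ij(2), of "Z i"] by blast
    then have "(i, l) \<in> P"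
      using ij by (simp add: PZ)
    then show False
      using ij by force
  qed
  obtain T' where T': "unitriangular_inverses J T T'"
    using column_reducer_props(1)[OF J I] T_def by blast
  have invT: "mat_inv J T = T'"
    by (rule mat_inv_unitriangular[OF J T'])
  have XW: "X i j = (\<Sum>k\<in>snd ` P. W i k * T' k j)" if "i \<in> I" "j \<in> J" for i j
  proof -
    have "X i j = mat_mul J W T' i j"
      using T' that by (simp add: W_def mat_mul_assoc unitriangular_inverses_def mat_mul_id_right J)
    also have "\<dots> = (\<Sum>k\<in>snd ` P. W i k * T' k j)"
      unfolding mat_mul_def using J PIJ W0 that by (intro sum.mono_neutral_right) auto
    finally show ?thesis .
  qed
  have leadT': "is_lead J (T' j) j" if "j \<in> J" for j
    using T' that by (auto simp: unitriangular_inverses_def unitriangular_def is_lead_def)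
  define R where "R = column_reducer J I (mat_transpose X)"
  obtain R' where R': "unitriangular_inverses I R R'"
    using column_reducer_props(1)[OF I J] R_def by blast
  define S' where "S' = mat_transpose R'"
  have S: "S = mat_transpose R"
    by (simp add: S_def R_def row_reducer_def)
  have invS: "mat_inv I S = S'"
    unfolding S S'_def by (rule mat_inv_transpose[OF I R'])
  have S'S: "mat_mul I S' S = id_mat I"
    using R' by (simp add: S S'_def transpose_mul[symmetric] unitriangular_inverses_def transpose_id)
  have XZ: "X i j = (\<Sum>k\<in>fst ` P. S' i k * Z k j)" if "i \<in> I" "j \<in> J" for i j
  proof -
    have "X i j = mat_mul I S' Z i j"
      using that by (simp add: Z_def mat_mul_assoc[symmetric] S'S mat_mul_id_left I)
    also have "\<dots> = (\<Sum>k\<in>fst ` P. S' i k * Z k j)"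
      unfolding mat_mul_def using I PIJ Z0 that by (intro sum.mono_neutral_right) auto
    finally show ?thesis .
  qed
  have leadS': "is_lead I (\<lambda>k. S' k i) i" if "i \<in> I" for i
    using R' that by (auto simp: S'_def mat_transpose_def unitriangular_inverses_def unitriangular_def is_lead_def)
  \<comment> \<open>\<open>q\<close> and \<open>q'\<close> are defined from all pivots; they agree
    with \<open>p\<close> and \<open>p'\<close> on nontrivial ones, while the latter are unspecified
    at trivial ones.\<close>
  define q where "q j = (THE i. (i, j) \<in> P)" for j
  define q' where "q' i = (THE j. (i, j) \<in> P)" for i
  have qI: "q j = i" and q'I: "q' i = j" if "(i, j) \<in> P" for i j
    unfolding q_def q'_def using that uniq_row uniq_col by (blast intro: the_equality)+
  have pI: "p j = i" and p'I: "p' i = j" if "(i, j) \<in> N" for i j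
    unfolding p_def p'_def using that uniq_row uniq_col NP by (blast intro: the_equality)+
  note decomposition = echelon_image_decomposition[OF U V orders X, folded im_def]
  \<comment> \<open>The column factorization, reindexed by pivot positions along \<open>snd\<close>,
    which is injective on \<open>P\<close>.\<close>
  have "\<exists>\<gamma>. interval_decomposition im N (\<lambda>(i, j). b' j) (\<lambda>(i, j). d i) \<gamma>
     \<and> represents U J b' d' \<alpha> im N (\<lambda>(i, j). b' j) (\<lambda>(i, j). d i) \<gamma> (\<lambda>(i, j). T' j) \<phi>
     \<and> represents im N (\<lambda>(i, j). b' j) (\<lambda>(i, j). d i) \<gamma> V I b d \<beta> (\<lambda>i (_, j). W i j) (\<lambda>t v. v)"
  proof (rule decomposition[where q = fst and q' = snd and K = P])
    show "X i j = (\<Sum>k\<in>P. (case k of (_, l) \<Rightarrow> W i l) * (case k of (_, l) \<Rightarrow> T' l) j)"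
      if "i \<in> I" "j \<in> J" for i j
      unfolding XW[OF that] sum.reindex[OF inj(2)] by (simp add: case_prod_beta)
  qed (use finP inj leadT' in \<open>auto simp: PW NP\<close>)
  then have barcode: "has_barcode im N (\<lambda>(i, j). b' j) (\<lambda>(i, j). d i)"
    by (auto simp: has_barcode_def)
  have rows: "\<exists>\<gamma>. interval_decomposition im P\<^sub>I (\<lambda>i. b' (p' i)) d \<gamma>
     \<and> represents U J b' d' \<alpha> im P\<^sub>I (\<lambda>i. b' (p' i)) d \<gamma> Z \<phi>
     \<and> represents im P\<^sub>I (\<lambda>i. b' (p' i)) d \<gamma> V I b d \<beta> S' (\<lambda>t v. v)"
  \<comment> \<open>\<open>S'\<close> is lower unitriangular, so its column \<open>i\<close> leads
    at \<open>i\<close> itself and \<open>q\<close> is the identity; only the pivot column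
    \<open>q' i\<close> is read off \<open>S X\<close>.\<close>
  proof (rule decomposition[where q = "\<lambda>i. i" and q' = q' and K = "fst ` P"])
    show "inj_on q' (fst ` P)"
      using uniq_row by (auto simp: inj_on_def q'I)
    show "is_lead J (Z i) (q' i)" if "i \<in> fst ` P" for i
      using that by (auto simp: q'I) (simp add: PZ)
    show "P\<^sub>I = {i \<in> fst ` P. b' (q' i) < d i}"
      unfolding P\<^sub>I_def using NP by (force simp: q'I image_iff)
    show "b' (p' i) = b' (q' i)" if "i \<in> P\<^sub>I" for i
      using that NP by (auto simp: P\<^sub>I_def p'I q'I)
  qed (use finP XZ leadS' PIJ in auto)
  have cols: "\<exists>\<gamma>. interval_decomposition im P\<^sub>J b' (\<lambda>j. d (p j)) \<gamma>
     \<and> represents U J b' d' \<alpha> im P\<^sub>J b' (\<lambda>j. d (p j)) \<gamma> T' \<phi>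
     \<and> represents im P\<^sub>J b' (\<lambda>j. d (p j)) \<gamma> V I b d \<beta> W (\<lambda>t v. v)"
  proof (rule decomposition[where q = q and q' = "\<lambda>j. j" and K = "snd ` P"])
    show "inj_on q (snd ` P)"
      using uniq_col by (auto simp: inj_on_def qI)
    show "is_lead I (\<lambda>i. W i j) (q j)" if "j \<in> snd ` P" for j
      using that by (auto simp: qI) (simp add: PW)
    show "P\<^sub>J = {j \<in> snd ` P. b' j < d (q j)}"
      unfolding P\<^sub>J_def using NP by (force simp: qI image_iff)
    show "d (p j) = d (q j)" if "j \<in> P\<^sub>J" for j
      using that NP by (auto simp: P\<^sub>J_def pI qI)
  qed (use finP XW leadT' PIJ in auto)
  show ?thesis
    using barcode rows cols by (simp add: invS invT Z_def W_def)
qed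

end
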